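(* Let $\alpha=(A,(A_i)_{i\in I_\alpha})$ and $\beta=(B,(B_i)_{i\in I_\beta})$ be two coset incidence systems (with finite type sets), let $\varphi: B\to \mathrm{Aut}(A)$ be a group homomorphism, and suppose that $\alpha$ is $(\beta,\varphi)$-admissible. Suppose that $A$ is flag-transitive on $\alpha$ and $B$ is flag-transitive on $\beta$. Let $\mathcal{T}(\alpha,\beta)$ be the twisting of $\alpha$ by $\beta$ (with respect to $\varphi$ and a choice of orbit representatives $(F_L)_{L\in K}$ as in the definition of admissibility). Then: (a) the group $G=A\rtimes_\varphi B$ is flag-transitive on $\mathcal{T}(\alpha,\beta)$; (b) $\mathcal{T}(\alpha,\beta)$ is a coset geometry; (c) $\mathcal{T}(\alpha,\beta)$ is a finite coset geometry if and only if $\alpha$ and $\beta$ are both finite coset geometries; (d) $\mathcal{T}(\alpha,\beta)$ is residually connected if both $\alpha$ and $\beta$ are residually connected; (e) $\mathcal{T}(\alpha,\beta)$ is firm if both $\alpha$ and $\beta$ are firm. Moreover, if the Borel subgroups $A_{I_\alpha}$ and $B_{I_\beta}$ are trivial, then $\mathcal{T}(\alpha,\beta)$ is thin if both $\alpha$ and $\beta$ are thin.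
   Context: All type sets are finite. An incidence system over a type set $I$ consists of a set $X$ of elements, a type map $t:X\to I$, and a symmetric reflexive incidence relation $*$ on $X$ such that distinct incident elements have distinct types. A flag is a set of pairwise incident elements; its type is the set of types of its elements; a chamber is a flag of type $I$. The system is a geometry if all maximal flags are chambers. The residue of a flag $F$ is the incidence system formed by the elements incident to all elements of $F$ but not in $F$; for a geometry its rank is $|I|-|F|$. A geometry is residually connected if every residue (including the residue of the empty flag) of rank at least two has a connected incidence graph. It is firm (resp. thin) if each residue of a flag of corank one contains at least two (resp. exactly two) elements. It is finite if its incidence graph is finite. A coset incidence system $(G,(G_i)_{i\in I})$ consists of a group $G$ and subgroups $G_i\le G$; it is the incidence system over $I$ whose elements of type $i$ are the left cosets $gG_i$, with $gG_i$ incident to $kG_j$ iff $gG_i\cap kG_j\neq\emptyset$. It is a coset geometry if it is a geometry. For $J\subseteq I$ put $G_J=\bigcap_{j\in J}G_j$, with $G_\emptyset=G$; $G_I$ is the Borel subgroup. $G$ acts by left multiplication, and is flag-transitive if, for every $J\subseteq I$, it is transitive on the flags of type $J$. Admissibility: $\alpha$ is $(\beta,\varphi)$-admissible if (1) the action $\varphi$ of $B$ on $A$ permutes the maximal parabolic subgroups $(A_i)_{i\in I_\alpha}$, so that $B$ acts on $I_\alpha$ with $\varphi(b)(A_i)=A_{b\cdot i}$; and (2) letting $K$ be the set of orbits of $B$ on $I_\alpha$, for each $L\in K$ there exists $F_L\in L$ such that for all $M,N\subseteq I_\beta$, ${}^LO_M\cap {}^LO_N={}^LO_{M\cap N}$ (condition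 (IPO)), where ${}^LO_M$ is the orbit of $F_L$ under $B_{I_\beta\setminus M}$. Twisting: put ${}^LO^J={}^LO_{I_\beta\setminus J}$, i.e. the orbit of $F_L$ under $B_J$, for $J\subseteq I_\beta$ (and ${}^LO^i={}^LO^{\{i\}}$). Fix representatives $(F_L)_{L\in K}$ satisfying (2). The twisting $\mathcal{T}(\alpha,\beta)$ is the coset incidence system $(G,(G_i)_{i\in I})$ over $I=I_\beta\sqcup K$ with $G=A\rtimes_\varphi B$, $G_i=A_{\bigcup_{L\in K}(L\setminus {}^LO^i)}\rtimes B_i$ if $i\in I_\beta$, and $G_i=A_i\rtimes B$ if $i\in K$ (here $i\subseteq I_\alpha$ is an orbit and $A_i=\bigcap_{l\in i}A_l$). *)

theory Defs
  imports "HOL-Algebra.Bij" "HOL-Algebra.Coset" "HOL-Algebra.Group_Action"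
begin

section \<open>Incidence systems\<close>

record ('i, 'x) incidence_structure =
  type_set :: "'i set"
  elements :: "'x set"
  type_map :: "'x \<Rightarrow> 'i"
  inc :: "'x \<Rightarrow> 'x \<Rightarrow> bool"

locale incidence_system =
  fixes X :: "('i, 'x) incidence_structure"
  assumes finite_type_set: "finite (type_set X)"
    and type_map_in: "x \<in> elements X \<Longrightarrow> type_map X x \<in> type_set X"
    and inc_refl: "x \<in> elements X \<Longrightarrow> inc X x x"
    and inc_sym: "\<lbrakk>x \<in> elements X; y \<in> elements X; inc X x y\<rbrakk> \<Longrightarrow> inc X y x"
    and inc_type_map: "\<lbrakk>x \<in> elements X; y \<in> elements X; inc X x y; x \<noteq> y\<rbrakk> \<Longrightarrow> type_map X x \<noteq> type_map X y"

definition flag :: "('i, 'x) incidence_structure \<Rightarrow> 'x set \<Rightarrow> bool" where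
  "flag X F \<longleftrightarrow> F \<subseteq> elements X \<and> (\<forall>x\<in>F. \<forall>y\<in>F. inc X x y)"

definition flag_type :: "('i, 'x) incidence_structure \<Rightarrow> 'x set \<Rightarrow> 'i set" where
  "flag_type X F = type_map X ` F"

definition maximal_flag :: "('i, 'x) incidence_structure \<Rightarrow> 'x set \<Rightarrow> bool" where
  "maximal_flag X F \<longleftrightarrow> flag X F \<and> (\<forall>F'. flag X F' \<and> F \<subseteq> F' \<longrightarrow> F' = F)"

definition chamber :: "('i, 'x) incidence_structure \<Rightarrow> 'x set \<Rightarrow> bool" where
  "chamber X F \<longleftrightarrow> flag X F \<and> flag_type X F = type_set X"

definition geometry :: "('i, 'x) incidence_structure \<Rightarrow> bool" where
  "geometry X \<longleftrightarrow> incidence_system X \<and> (\<forall>F. maximal_flag X F \<longrightarrow> chamber X F)"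

definition residue ::
  "('i, 'x) incidence_structure \<Rightarrow> 'x set \<Rightarrow> ('i, 'x) incidence_structure" where
  "residue X F =
    \<lparr>type_set = type_set X - flag_type X F,
     elements = {x \<in> elements X. x \<notin> F \<and> (\<forall>y\<in>F. inc X x y)},
     type_map = type_map X,
     inc = inc X\<rparr>"

text \<open>The corank of a flag, i.e. the rank of its residue. In an incidence system a flag has at
  most as many elements as there are types, so the subtraction does not truncate.\<close>

definition corank :: "('i, 'x) incidence_structure \<Rightarrow> 'x set \<Rightarrow> nat" where
  "corank X F = card (type_set X) - card F"

definition incidence_graph :: "('i, 'x) incidence_structure \<Rightarrow> 'x rel" where
  "incidence_graph X = {(x, y). x \<in> elements X \<and> y \<in> elements X \<and> x \<noteq> y \<and> inc X x y}"

definition connected_system :: "('i, 'x) incidence_structure \<Rightarrow> bool" where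
  "connected_system X \<longleftrightarrow>
    (\<forall>x \<in> elements X. \<forall>y \<in> elements X. (x, y) \<in> (incidence_graph X)\<^sup>*)"

definition residually_connected :: "('i, 'x) incidence_structure \<Rightarrow> bool" where
  "residually_connected X \<longleftrightarrow>
    geometry X \<and> (\<forall>F. flag X F \<and> corank X F \<ge> 2 \<longrightarrow> connected_system (residue X F))"

definition firm :: "('i, 'x) incidence_structure \<Rightarrow> bool" where
  "firm X \<longleftrightarrow> geometry X \<and>
    (\<forall>F. flag X F \<and> corank X F = 1 \<longrightarrow>
      (\<exists>x \<in> elements (residue X F). \<exists>y \<in> elements (residue X F). x \<noteq> y))"

definition thin :: "('i, 'x) incidence_structure \<Rightarrow> bool" where
  "thin X \<longleftrightarrow> geometry X \<and>
    (\<forall>F. flag X F \<and> corank X F = 1 \<longrightarrow> card (elements (residue X F)) = 2)"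

text \<open>The incidence graph is finite iff its vertex set, the set of elements, is.\<close>

definition finite_system :: "('i, 'x) incidence_structure \<Rightarrow> bool" where
  "finite_system X \<longleftrightarrow> finite (elements X)"


section \<open>Coset incidence systems\<close>

record ('i, 'a) coset_data =
  grp :: "'a monoid"
  idx :: "'i set"
  par :: "'i \<Rightarrow> 'a set"

locale coset_incidence_system =
  fixes \<alpha> :: "('i, 'a) coset_data"
  assumes group_grp: "group (grp \<alpha>)"
    and finite_idx: "finite (idx \<alpha>)"
    and subgroup_par: "i \<in> idx \<alpha> \<Longrightarrow> subgroup (par \<alpha> i) (grp \<alpha>)"

text \<open>An element is a coset tagged with its type, since the same coset may occur for several
  types.\<close>

definition coset_system :: "('i, 'a) coset_data \<Rightarrow> ('i, 'i \<times> 'a set) incidence_structure" where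
  "coset_system \<alpha> =
    \<lparr>type_set = idx \<alpha>,
     elements = {(i, g <#\<^bsub>grp \<alpha>\<^esub> par \<alpha> i) | i g. i \<in> idx \<alpha> \<and> g \<in> carrier (grp \<alpha>)},
     type_map = fst,
     inc = (\<lambda>x y. snd x \<inter> snd y \<noteq> {})\<rparr>"

definition coset_geometry :: "('i, 'a) coset_data \<Rightarrow> bool" where
  "coset_geometry \<alpha> \<longleftrightarrow> coset_incidence_system \<alpha> \<and> geometry (coset_system \<alpha>)"

definition finite_coset_geometry :: "('i, 'a) coset_data \<Rightarrow> bool" where
  "finite_coset_geometry \<alpha> \<longleftrightarrow> coset_geometry \<alpha> \<and> finite_system (coset_system \<alpha>)"

text \<open>Intersecting with the carrier gives the convention that the empty intersection is the
  whole group.\<close>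

definition parabolic :: "('i, 'a) coset_data \<Rightarrow> 'i set \<Rightarrow> 'a set" where
  "parabolic \<alpha> J = carrier (grp \<alpha>) \<inter> (\<Inter>j\<in>J. par \<alpha> j)"

definition borel :: "('i, 'a) coset_data \<Rightarrow> 'a set" where
  "borel \<alpha> = parabolic \<alpha> (idx \<alpha>)"

definition translate :: "('i, 'a) coset_data \<Rightarrow> 'a \<Rightarrow> 'i \<times> 'a set \<Rightarrow> 'i \<times> 'a set" where
  "translate \<alpha> g x = (fst x, g <#\<^bsub>grp \<alpha>\<^esub> snd x)"

definition flag_transitive :: "('i, 'a) coset_data \<Rightarrow> bool" where
  "flag_transitive \<alpha> \<longleftrightarrow>
    (\<forall>J \<subseteq> idx \<alpha>. \<forall>F F'.
      flag (coset_system \<alpha>) F \<and> flag_type (coset_system \<alpha>) F = J \<and>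
      flag (coset_system \<alpha>) F' \<and> flag_type (coset_system \<alpha>) F' = J \<longrightarrow>
      (\<exists>g \<in> carrier (grp \<alpha>). translate \<alpha> g ` F = F'))"


section \<open>Admissibility and twisting\<close>

definition semidirect ::
  "'a monoid \<Rightarrow> 'b monoid \<Rightarrow> ('b \<Rightarrow> 'a \<Rightarrow> 'a) \<Rightarrow> ('a \<times> 'b) monoid" where
  "semidirect A B \<phi> =
    \<lparr>carrier = carrier A \<times> carrier B,
     mult = (\<lambda>(a, b) (a', b'). (a \<otimes>\<^bsub>A\<^esub> \<phi> b a', b \<otimes>\<^bsub>B\<^esub> b')),
     one = (\<one>\<^bsub>A\<^esub>, \<one>\<^bsub>B\<^esub>)\<rparr>"

text \<open>Here \<open>\<sigma>\<close> is the action of \<open>B\<close> on the type set of \<open>\<alpha>\<close>. It is a separate parameter because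
  \<open>\<phi>\<close> determines it only when the maximal parabolic subgroups of \<open>\<alpha>\<close> are pairwise distinct.
  \<open>orbit_upper\<close> is the orbit of a type \<open>f\<close> under the parabolic subgroup of type \<open>J\<close>, written with
  superscript \<open>J\<close>; \<open>orbit_lower\<close> is the orbit written with subscript \<open>M\<close>.\<close>

definition orbit_upper ::
  "('j, 'b) coset_data \<Rightarrow> ('b \<Rightarrow> 'i \<Rightarrow> 'i) \<Rightarrow> 'i \<Rightarrow> 'j set \<Rightarrow> 'i set" where
  "orbit_upper \<beta> \<sigma> f J = orbit ((grp \<beta>)\<lparr>carrier := parabolic \<beta> J\<rparr>) \<sigma> f"

definition orbit_lower ::
  "('j, 'b) coset_data \<Rightarrow> ('b \<Rightarrow> 'i \<Rightarrow> 'i) \<Rightarrow> 'i \<Rightarrow> 'j set \<Rightarrow> 'i set" where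
  "orbit_lower \<beta> \<sigma> f M = orbit_upper \<beta> \<sigma> f (idx \<beta> - M)"

definition IPO :: "('j, 'b) coset_data \<Rightarrow> ('b \<Rightarrow> 'i \<Rightarrow> 'i) \<Rightarrow> 'i \<Rightarrow> bool" where
  "IPO \<beta> \<sigma> f \<longleftrightarrow>
    (\<forall>M N. M \<subseteq> idx \<beta> \<and> N \<subseteq> idx \<beta> \<longrightarrow>
      orbit_lower \<beta> \<sigma> f M \<inter> orbit_lower \<beta> \<sigma> f N = orbit_lower \<beta> \<sigma> f (M \<inter> N))"

definition permutes_parabolics ::
  "('i, 'a) coset_data \<Rightarrow> ('j, 'b) coset_data \<Rightarrow> ('b \<Rightarrow> 'a \<Rightarrow> 'a) \<Rightarrow> ('b \<Rightarrow> 'i \<Rightarrow> 'i) \<Rightarrow> bool" where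
  "permutes_parabolics \<alpha> \<beta> \<phi> \<sigma> \<longleftrightarrow>
    group_action (grp \<beta>) (idx \<alpha>) \<sigma> \<and>
    (\<forall>b \<in> carrier (grp \<beta>). \<forall>i \<in> idx \<alpha>. \<phi> b ` par \<alpha> i = par \<alpha> (\<sigma> b i))"

abbreviation type_orbits ::
  "('i, 'a) coset_data \<Rightarrow> ('j, 'b) coset_data \<Rightarrow> ('b \<Rightarrow> 'i \<Rightarrow> 'i) \<Rightarrow> 'i set set" where
  "type_orbits \<alpha> \<beta> \<sigma> \<equiv> orbits (grp \<beta>) (idx \<alpha>) \<sigma>"

text \<open>\<open>\<alpha>\<close> is \<open>(\<beta>, \<phi>)\<close>-admissible iff \<open>admissible_with \<alpha> \<beta> \<phi> \<sigma> f\<close> holds for some action \<open>\<sigma>\<close> and some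
  family \<open>f\<close> of orbit representatives (\<open>f L\<close> representing the orbit \<open>L\<close>). The witnesses are kept
  as parameters because the twisting depends on them.\<close>

definition admissible_with ::
  "('i, 'a) coset_data \<Rightarrow> ('j, 'b) coset_data \<Rightarrow> ('b \<Rightarrow> 'a \<Rightarrow> 'a) \<Rightarrow> ('b \<Rightarrow> 'i \<Rightarrow> 'i) \<Rightarrow>
    ('i set \<Rightarrow> 'i) \<Rightarrow> bool" where
  "admissible_with \<alpha> \<beta> \<phi> \<sigma> f \<longleftrightarrow>
    permutes_parabolics \<alpha> \<beta> \<phi> \<sigma> \<and>
    (\<forall>L \<in> type_orbits \<alpha> \<beta> \<sigma>. f L \<in> L \<and> IPO \<beta> \<sigma> (f L))"

definition twisting ::
  "('i, 'a) coset_data \<Rightarrow> ('j, 'b) coset_data \<Rightarrow> ('b \<Rightarrow> 'a \<Rightarrow> 'a) \<Rightarrow> ('b \<Rightarrow> 'i \<Rightarrow> 'i) \<Rightarrow>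
    ('i set \<Rightarrow> 'i) \<Rightarrow> ('j + 'i set, 'a \<times> 'b) coset_data" where
  "twisting \<alpha> \<beta> \<phi> \<sigma> f =
    \<lparr>grp = semidirect (grp \<alpha>) (grp \<beta>) \<phi>,
     idx = idx \<beta> <+> type_orbits \<alpha> \<beta> \<sigma>,
     par = (\<lambda>k. case k of
         Inl i \<Rightarrow> parabolic \<alpha> (\<Union>L \<in> type_orbits \<alpha> \<beta> \<sigma>. L - orbit_upper \<beta> \<sigma> (f L) {i}) \<times> par \<beta> i
       | Inr L \<Rightarrow> parabolic \<alpha> L \<times> carrier (grp \<beta>))\<rparr>"

end

theory Submission
  imports Defs "HOL-Algebra.Left_Coset"
begin

text \<open>Flag-transitivity of a coset incidence system amounts to a Helly property: pairwise
  intersecting cosets of maximal parabolic subgroups have a common element, and then the same holds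
  for cosets of arbitrary parabolic subgroups. In the twisting every coset of a maximal parabolic
  subgroup is the product of a coset of a parabolic subgroup of \<open>\<alpha>\<close> and one of \<open>\<beta>\<close>, so the Helly
  property is inherited, and with it flag-transitivity and the geometry property.

  For flag-transitive systems the remaining properties translate into statements about parabolic
  subgroups: residual connectedness says that a parabolic subgroup of corank at least two is
  generated by the parabolic subgroups properly contained in it, firmness that the parabolic
  subgroups of corank one are strictly larger than the Borel subgroup, and, when the Borel subgroup
  is trivial, thinness that they have order two. A parabolic subgroup of the twisting is a product
  of parabolic subgroups, and condition (IPO) identifies the types of its factor in \<open>\<alpha>\<close>: what they
  leave out is a union of orbits of the factor in \<open>\<beta>\<close>.\<close>

section \<open>Flag-transitive coset incidence systems\<close>

lemma (in group) mem_lcos_iff: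
  assumes "g \<in> carrier G" "subgroup H G"
  shows "x \<in> g <# H \<longleftrightarrow> x \<in> carrier G \<and> inv g \<otimes> x \<in> H"
  using subgroup.lcos_module_imp[OF assms(2) is_group assms(1)]
    subgroup.lcos_module_rev[OF assms(2) is_group assms(1)]
    l_coset_carrier[OF _ assms] by metis

lemma (in group) lcos_mult_mem:
  assumes "g \<in> carrier G" "x \<in> carrier G" "subgroup H G" "h \<in> H"
  shows "(g \<otimes> (x \<otimes> h)) <# H = (g \<otimes> x) <# H"
proof (rule l_repr_independence[symmetric])
  have "h \<in> carrier G" using subgroup.mem_carrier[OF assms(3,4)] .
  then have "g \<otimes> (x \<otimes> h) = (g \<otimes> x) \<otimes> h" using assms(1,2) by (simp add: m_assoc)
  then show "g \<otimes> (x \<otimes> h) \<in> (g \<otimes> x) <# H" using assms(4) unfolding l_coset_def by blast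
qed (use assms in simp_all)

text \<open>Elements of the residue of \<open>std_flag \<alpha> g J\<close> are cosets of products
  \<open>g \<otimes> x\<close>; the criterion removes the base point g, so that telling them apart
  is a question about x and y alone.\<close>

lemma (in group) lcos_mult_eq_iff:
  assumes "g \<in> carrier G" "x \<in> carrier G" "y \<in> carrier G" "subgroup H G"
  shows "(g \<otimes> x) <# H = (g \<otimes> y) <# H \<longleftrightarrow> inv x \<otimes> y \<in> H"
proof -
  have "(g \<otimes> x) <# H = (g \<otimes> y) <# H \<longleftrightarrow>
      g \<otimes> y \<in> (g \<otimes> x) <# H"
    using l_repr_independence lcos_self assms m_closed by metis
  moreover have "inv (g \<otimes> x) \<otimes> (g \<otimes> y) = inv x \<otimes> y"
  proof -
    have "inv g \<otimes> (g \<otimes> y) = y"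
      using assms(1,3) by (metis inv_closed m_assoc l_inv l_one)
    then show ?thesis using assms(1-3) by (simp add: inv_mult_group m_assoc)
  qed
  ultimately show ?thesis using assms by (simp add: mem_lcos_iff)
qed

section \<open>Flags with a common element and the Helly property\<close>

definition std_flag :: "('i, 'a) coset_data \<Rightarrow> 'a \<Rightarrow> 'i set \<Rightarrow> ('i \<times> 'a set) set" where
  "std_flag \<alpha> g J = (\<lambda>j. (j, g <#\<^bsub>grp \<alpha>\<^esub> par \<alpha> j)) ` J"

text \<open>The cosets form a family indexed by type, which removes the tags of
  \<open>coset_system\<close>. Flag-transitivity of the twisting is verified in this form.\<close>

definition helly :: "('i, 'a) coset_data \<Rightarrow> bool" where
  "helly \<alpha> \<longleftrightarrow> (\<forall>J \<subseteq> idx \<alpha>. \<forall>c.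
     (\<forall>j \<in> J. c j \<in> (\<lambda>g. g <#\<^bsub>grp \<alpha>\<^esub> par \<alpha> j) ` carrier (grp \<alpha>)) \<longrightarrow>
     (\<forall>i \<in> J. \<forall>j \<in> J. c i \<inter> c j \<noteq> {}) \<longrightarrow> (\<exists>g \<in> carrier (grp \<alpha>). \<forall>j \<in> J. g \<in> c j))"

lemma parabolic_antimono: "J \<subseteq> J' \<Longrightarrow> parabolic \<alpha> J' \<subseteq> parabolic \<alpha> J"
  unfolding parabolic_def by blast

lemma parabolic_insert: "parabolic \<alpha> (insert i J) = parabolic \<alpha> J \<inter> par \<alpha> i"
  unfolding parabolic_def by blast

lemma elements_coset_system:
  "elements (coset_system \<alpha>) =
     {(i, g <#\<^bsub>grp \<alpha>\<^esub> par \<alpha> i) | i g. i \<in> idx \<alpha> \<and> g \<in> carrier (grp \<alpha>)}"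
  and type_set_coset_system [simp]: "type_set (coset_system \<alpha>) = idx \<alpha>"
  and type_map_coset_system [simp]: "type_map (coset_system \<alpha>) = fst"
  and inc_coset_system [simp]: "inc (coset_system \<alpha>) x y \<longleftrightarrow> snd x \<inter> snd y \<noteq> {}"
  by (simp_all add: coset_system_def)

lemma flag_type_std_flag [simp]: "flag_type (coset_system \<alpha>) (std_flag \<alpha> g J) = J"
  by (force simp: flag_type_def std_flag_def)

lemma card_std_flag [simp]: "card (std_flag \<alpha> g J) = card J"
  unfolding std_flag_def by (rule card_image) (auto simp: inj_on_def)

context coset_incidence_system
begin

interpretation group "grp \<alpha>" by (rule group_grp)

lemma subgroup_parabolic:
  assumes "J \<subseteq> idx \<alpha>" shows "subgroup (parabolic \<alpha> J) (grp \<alpha>)"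
proof (rule subgroup.intro)
  have sub: "subgroup (par \<alpha> j) (grp \<alpha>)" if "j \<in> J" for j
    using that assms subgroup_par by blast
  show "parabolic \<alpha> J \<subseteq> carrier (grp \<alpha>)" unfolding parabolic_def by blast
  show "\<one>\<^bsub>grp \<alpha>\<^esub> \<in> parabolic \<alpha> J"
    unfolding parabolic_def using sub subgroup.one_closed by auto
  show "x \<otimes>\<^bsub>grp \<alpha>\<^esub> y \<in> parabolic \<alpha> J" if "x \<in> parabolic \<alpha> J" "y \<in> parabolic \<alpha> J" for x y
    using that sub by (auto simp: parabolic_def intro: subgroup.m_closed)
  show "inv\<^bsub>grp \<alpha>\<^esub> x \<in> parabolic \<alpha> J" if "x \<in> parabolic \<alpha> J" for x
    using that sub by (auto simp: parabolic_def intro: subgroup.m_inv_closed)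
qed

lemma parabolic_singleton: "i \<in> idx \<alpha> \<Longrightarrow> parabolic \<alpha> {i} = par \<alpha> i"
  unfolding parabolic_def using subgroup.subset[OF subgroup_par] by auto

text \<open>Lying in the coset of g means that \<open>inv g \<otimes> x\<close> lies in the
  subgroup, a condition that distributes over intersections. The clause about the carrier covers J
  empty.\<close>

lemma mem_lcos_parabolic_iff:
  assumes "g \<in> carrier (grp \<alpha>)" "J \<subseteq> idx \<alpha>"
  shows "x \<in> g <#\<^bsub>grp \<alpha>\<^esub> parabolic \<alpha> J \<longleftrightarrow>
    x \<in> carrier (grp \<alpha>) \<and> (\<forall>j \<in> J. x \<in> g <#\<^bsub>grp \<alpha>\<^esub> par \<alpha> j)"
proof -
  have "x \<in> g <#\<^bsub>grp \<alpha>\<^esub> par \<alpha> j \<longleftrightarrow> x \<in> carrier (grp \<alpha>) \<and> inv\<^bsub>grp \<alpha>\<^esub> g \<otimes>\<^bsub>grp \<alpha>\<^esub> x \<in> par \<alpha> j"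
    if "j \<in> J" for j
    using that assms by (intro mem_lcos_iff subgroup_par) auto
  then show ?thesis
    unfolding mem_lcos_iff[OF assms(1) subgroup_parabolic[OF assms(2)]]
    using assms(1) by (auto simp: parabolic_def)
qed

text \<open>Two cosets of one subgroup with a common element z are both the coset of z; equal tags
  ensure that the subgroup is the same.\<close>

lemma elements_eq_of_type:
  assumes "x \<in> elements (coset_system \<alpha>)" "y \<in> elements (coset_system \<alpha>)"
    "fst x = fst y" "snd x \<inter> snd y \<noteq> {}"
  shows "x = y"
proof -
  obtain i g where x: "x = (i, g <#\<^bsub>grp \<alpha>\<^esub> par \<alpha> i)"
    and i: "i \<in> idx \<alpha>" "g \<in> carrier (grp \<alpha>)"
    using assms(1) unfolding elements_coset_system by blast
  obtain h where y: "y = (i, h <#\<^bsub>grp \<alpha>\<^esub> par \<alpha> i)" and h: "h \<in> carrier (grp \<alpha>)"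
    using assms(2,3) x unfolding elements_coset_system by fastforce
  obtain z where z: "z \<in> g <#\<^bsub>grp \<alpha>\<^esub> par \<alpha> i" "z \<in> h <#\<^bsub>grp \<alpha>\<^esub> par \<alpha> i"
    using assms(4) x y by fastforce
  have "g <#\<^bsub>grp \<alpha>\<^esub> par \<alpha> i = z <#\<^bsub>grp \<alpha>\<^esub> par \<alpha> i"
    using l_repr_independence[OF z(1) i(2) subgroup_par[OF i(1)]] by simp
  also have "\<dots> = h <#\<^bsub>grp \<alpha>\<^esub> par \<alpha> i"
    using l_repr_independence[OF z(2) h subgroup_par[OF i(1)], symmetric] .
  finally show ?thesis using x y by simp
qed

lemma incidence_system_coset_system: "incidence_system (coset_system \<alpha>)"
proof
  show "finite (type_set (coset_system \<alpha>))" using finite_idx by simp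
  show "inc (coset_system \<alpha>) x x" if "x \<in> elements (coset_system \<alpha>)" for x
    using that lcos_self subgroup_par unfolding elements_coset_system by force
  show "type_map (coset_system \<alpha>) x \<noteq> type_map (coset_system \<alpha>) y"
    if "x \<in> elements (coset_system \<alpha>)" "y \<in> elements (coset_system \<alpha>)"
      "inc (coset_system \<alpha>) x y" "x \<noteq> y" for x y
    using elements_eq_of_type that by (simp, blast)
qed (auto simp: elements_coset_system)

lemma std_flag_subset: "g \<in> carrier (grp \<alpha>) \<Longrightarrow> J \<subseteq> idx \<alpha> \<Longrightarrow>
    std_flag \<alpha> g J \<subseteq> elements (coset_system \<alpha>)"
  unfolding std_flag_def elements_coset_system by blast

lemma flag_std_flag:
  assumes "g \<in> carrier (grp \<alpha>)" "J \<subseteq> idx \<alpha>"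
  shows "flag (coset_system \<alpha>) (std_flag \<alpha> g J)"
proof -
  have "g \<in> snd x" if "x \<in> std_flag \<alpha> g J" for x
    using that assms lcos_self subgroup_par unfolding std_flag_def by auto
  then show ?thesis unfolding flag_def using std_flag_subset[OF assms] by (simp, blast)
qed

text \<open>By \<open>elements_eq_of_type\<close> a flag has only one element of each type, so it is
  the graph of a function c on its type set, and choice picks out that function.\<close>

lemma flag_obtain:
  assumes "flag (coset_system \<alpha>) F"
  obtains c where "F = (\<lambda>j. (j, c j)) ` flag_type (coset_system \<alpha>) F"
    "flag_type (coset_system \<alpha>) F \<subseteq> idx \<alpha>"
    "\<And>j. j \<in> flag_type (coset_system \<alpha>) F \<Longrightarrow>
      c j \<in> (\<lambda>g. g <#\<^bsub>grp \<alpha>\<^esub> par \<alpha> j) ` carrier (grp \<alpha>)"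
    "\<And>i j. i \<in> flag_type (coset_system \<alpha>) F \<Longrightarrow> j \<in> flag_type (coset_system \<alpha>) F \<Longrightarrow>
      c i \<inter> c j \<noteq> {}"
proof -
  let ?J = "flag_type (coset_system \<alpha>) F"
  define c where "c j = (SOME C. (j, C) \<in> F)" for j
  have FE: "F \<subseteq> elements (coset_system \<alpha>)"
    and Fi: "\<And>x y. x \<in> F \<Longrightarrow> y \<in> F \<Longrightarrow> snd x \<inter> snd y \<noteq> {}"
    using assms unfolding flag_def by auto
  have c: "(j, c j) \<in> F" if "j \<in> ?J" for j
    using that unfolding c_def flag_type_def by (auto intro: someI)
  have "x = (fst x, c (fst x))" if x: "x \<in> F" for x
  proof (rule elements_eq_of_type)
    have "(fst x, c (fst x)) \<in> F" using c x unfolding flag_type_def by auto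
    then show "(fst x, c (fst x)) \<in> elements (coset_system \<alpha>)"
      "snd x \<inter> snd (fst x, c (fst x)) \<noteq> {}" using FE Fi x by blast+
  qed (use x FE in auto)
  then have 1: "F = (\<lambda>j. (j, c j)) ` ?J" using c unfolding flag_type_def by force
  have 2: "?J \<subseteq> idx \<alpha>" using FE unfolding flag_type_def elements_coset_system by auto
  have 3: "c j \<in> (\<lambda>g. g <#\<^bsub>grp \<alpha>\<^esub> par \<alpha> j) ` carrier (grp \<alpha>)" if "j \<in> ?J" for j
    using c[OF that] FE unfolding elements_coset_system by auto
  have 4: "c i \<inter> c j \<noteq> {}" if "i \<in> ?J" "j \<in> ?J" for i j
    using Fi[OF c[OF that(1)] c[OF that(2)]] by simp
  show thesis by (rule that[OF 1 2 3 4])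
qed

lemma translate_std_flag:
  assumes "g \<in> carrier (grp \<alpha>)" "h \<in> carrier (grp \<alpha>)" "J \<subseteq> idx \<alpha>"
  shows "translate \<alpha> h ` std_flag \<alpha> g J = std_flag \<alpha> (h \<otimes>\<^bsub>grp \<alpha>\<^esub> g) J"
proof -
  have "h <#\<^bsub>grp \<alpha>\<^esub> (g <#\<^bsub>grp \<alpha>\<^esub> par \<alpha> j) = (h \<otimes>\<^bsub>grp \<alpha>\<^esub> g) <#\<^bsub>grp \<alpha>\<^esub> par \<alpha> j" if "j \<in> J" for j
    using lcos_m_assoc[OF subgroup.subset[OF subgroup_par] assms(2,1)] that assms(3) by blast
  then show ?thesis unfolding std_flag_def translate_def image_image by (intro image_cong) simp_all
qed

text \<open>The translates of the base flag \<open>std_flag \<alpha> \<one> J\<close> are the flags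
  \<open>std_flag \<alpha> g J\<close>, so transitivity on the flags of type J means that each of
  them consists of the cosets of a single element g.\<close>

lemma flag_transitive_iff_std_flag:
  "flag_transitive \<alpha> \<longleftrightarrow> (\<forall>F. flag (coset_system \<alpha>) F \<longrightarrow>
     (\<exists>g \<in> carrier (grp \<alpha>). F = std_flag \<alpha> g (flag_type (coset_system \<alpha>) F)))"
  (is "_ = ?R")
proof
  assume ft: "flag_transitive \<alpha>"
  show ?R
  proof (intro allI impI)
    fix F assume F: "flag (coset_system \<alpha>) F"
    let ?J = "flag_type (coset_system \<alpha>) F"
    have J: "?J \<subseteq> idx \<alpha>" using F by (rule flag_obtain)
    obtain g where g: "g \<in> carrier (grp \<alpha>)" "translate \<alpha> g ` std_flag \<alpha> \<one>\<^bsub>grp \<alpha>\<^esub> ?J = F"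
      using ft[unfolded flag_transitive_def] J F flag_std_flag[OF one_closed J] flag_type_std_flag
      by metis
    then show "\<exists>g \<in> carrier (grp \<alpha>). F = std_flag \<alpha> g ?J"
      using translate_std_flag[OF one_closed g(1) J] by auto
  qed
next
  assume R: ?R
  show "flag_transitive \<alpha>" unfolding flag_transitive_def
  proof (intro allI impI, elim conjE)
    fix J F F'
    assume J: "J \<subseteq> idx \<alpha>" and F: "flag (coset_system \<alpha>) F" "flag_type (coset_system \<alpha>) F = J"
      and F': "flag (coset_system \<alpha>) F'" "flag_type (coset_system \<alpha>) F' = J"
    obtain g g' where g: "g \<in> carrier (grp \<alpha>)" "F = std_flag \<alpha> g J"
      and g': "g' \<in> carrier (grp \<alpha>)" "F' = std_flag \<alpha> g' J"
      using R F F' by metis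
    let ?h = "g' \<otimes>\<^bsub>grp \<alpha>\<^esub> inv\<^bsub>grp \<alpha>\<^esub> g"
    have "translate \<alpha> ?h ` F = F'"
      using translate_std_flag[OF g(1) _ J, of ?h] g g' by (simp add: m_assoc)
    then show "\<exists>h \<in> carrier (grp \<alpha>). translate \<alpha> h ` F = F'" using g(1) g'(1) by blast
  qed
qed

text \<open>A flag is a family of pairwise intersecting cosets, and the elements g common to its
  members are those for which it equals \<open>std_flag \<alpha> g J\<close>.\<close>

lemma flag_transitive_iff_helly: "flag_transitive \<alpha> \<longleftrightarrow> helly \<alpha>"
proof
  assume ft: "flag_transitive \<alpha>"
  show "helly \<alpha>" unfolding helly_def
  proof (intro allI impI)
    fix J c
    assume J: "J \<subseteq> idx \<alpha>" and c: "\<forall>j \<in> J. c j \<in> (\<lambda>g. g <#\<^bsub>grp \<alpha>\<^esub> par \<alpha> j) ` carrier (grp \<alpha>)"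
      and meet: "\<forall>i \<in> J. \<forall>j \<in> J. c i \<inter> c j \<noteq> {}"
    let ?F = "(\<lambda>j. (j, c j)) ` J"
    have F: "flag (coset_system \<alpha>) ?F"
      unfolding flag_def elements_coset_system using J c meet by fastforce
    have "flag_type (coset_system \<alpha>) ?F = J" unfolding flag_type_def by force
    then obtain g where g: "g \<in> carrier (grp \<alpha>)" "?F = std_flag \<alpha> g J"
      using ft F flag_transitive_iff_std_flag by metis
    have "g \<in> c j" if "j \<in> J" for j
    proof -
      have "(j, c j) \<in> std_flag \<alpha> g J" using g(2) that by blast
      then show ?thesis
        unfolding std_flag_def using that J g(1) subgroup_par lcos_self by auto
    qed
    then show "\<exists>g \<in> carrier (grp \<alpha>). \<forall>j \<in> J. g \<in> c j" using g(1) by blast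
  qed
next
  assume h: "helly \<alpha>"
  show "flag_transitive \<alpha>" unfolding flag_transitive_iff_std_flag
  proof (intro allI impI)
    fix F assume F: "flag (coset_system \<alpha>) F"
    let ?J = "flag_type (coset_system \<alpha>) F"
    from F obtain c where c: "F = (\<lambda>j. (j, c j)) ` ?J" "?J \<subseteq> idx \<alpha>"
      "\<And>j. j \<in> ?J \<Longrightarrow> c j \<in> (\<lambda>g. g <#\<^bsub>grp \<alpha>\<^esub> par \<alpha> j) ` carrier (grp \<alpha>)"
      "\<And>i j. i \<in> ?J \<Longrightarrow> j \<in> ?J \<Longrightarrow> c i \<inter> c j \<noteq> {}" by (rule flag_obtain) blast
    obtain g where g: "g \<in> carrier (grp \<alpha>)" "\<And>j. j \<in> ?J \<Longrightarrow> g \<in> c j"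
      using h[unfolded helly_def, rule_format, OF c(2,3,4)] by blast
    have "c j = g <#\<^bsub>grp \<alpha>\<^esub> par \<alpha> j" if "j \<in> ?J" for j
      using c(2) c(3)[OF that] g(2)[OF that] that l_repr_independence subgroup_par by blast
    then have "F = std_flag \<alpha> g ?J" unfolding std_flag_def by (subst c(1)) (rule image_cong, auto)
    then show "\<exists>g \<in> carrier (grp \<alpha>). F = std_flag \<alpha> g ?J" using g(1) by blast
  qed
qed

text \<open>Inside the carrier, a coset of \<open>parabolic \<alpha> (S k)\<close> is the
  intersection of the members of \<open>std_flag \<alpha> (a k) (S k)\<close>. As these cosets meet
  pairwise, the union of the flags is a flag again, and an element common to its members lies in
  every given coset.\<close>

lemma helly_parabolic:
  assumes ft: "flag_transitive \<alpha>"
    and S: "\<And>k. k \<in> K \<Longrightarrow> S k \<subseteq> idx \<alpha>" and a: "\<And>k. k \<in> K \<Longrightarrow> a k \<in> carrier (grp \<alpha>)"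
    and meet: "\<And>k l. k \<in> K \<Longrightarrow> l \<in> K \<Longrightarrow>
      (a k <#\<^bsub>grp \<alpha>\<^esub> parabolic \<alpha> (S k)) \<inter> (a l <#\<^bsub>grp \<alpha>\<^esub> parabolic \<alpha> (S l)) \<noteq> {}"
  obtains g where "g \<in> carrier (grp \<alpha>)" "\<And>k. k \<in> K \<Longrightarrow> g \<in> a k <#\<^bsub>grp \<alpha>\<^esub> parabolic \<alpha> (S k)"
proof -
  let ?F = "\<Union>k\<in>K. std_flag \<alpha> (a k) (S k)"
  have "snd x \<inter> snd y \<noteq> {}" if xy: "x \<in> ?F" "y \<in> ?F" for x y
  proof -
    obtain k l s t where kl: "k \<in> K" "l \<in> K" "s \<in> S k" "t \<in> S l"
      "x = (s, a k <#\<^bsub>grp \<alpha>\<^esub> par \<alpha> s)" "y = (t, a l <#\<^bsub>grp \<alpha>\<^esub> par \<alpha> t)"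
      using xy unfolding std_flag_def by blast
    obtain z where "z \<in> a k <#\<^bsub>grp \<alpha>\<^esub> parabolic \<alpha> (S k)" "z \<in> a l <#\<^bsub>grp \<alpha>\<^esub> parabolic \<alpha> (S l)"
      using meet[OF kl(1,2)] by blast
    then have "z \<in> snd x \<inter> snd y" using kl S a by (auto simp: mem_lcos_parabolic_iff)
    then show ?thesis by blast
  qed
  moreover have "?F \<subseteq> elements (coset_system \<alpha>)"
    using std_flag_subset[OF a S] by (intro UN_least) simp
  ultimately have F: "flag (coset_system \<alpha>) ?F" unfolding flag_def by simp
  obtain J g where g: "g \<in> carrier (grp \<alpha>)" and J: "?F = std_flag \<alpha> g J"
    using ft[unfolded flag_transitive_iff_std_flag, rule_format, OF F] by blast
  have "g \<in> a k <#\<^bsub>grp \<alpha>\<^esub> par \<alpha> s" if "k \<in> K" "s \<in> S k" for k s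
  proof -
    have "(s, a k <#\<^bsub>grp \<alpha>\<^esub> par \<alpha> s) \<in> ?F" using that unfolding std_flag_def by blast
    then have "(s, a k <#\<^bsub>grp \<alpha>\<^esub> par \<alpha> s) \<in> std_flag \<alpha> g J" unfolding J .
    then have "a k <#\<^bsub>grp \<alpha>\<^esub> par \<alpha> s = g <#\<^bsub>grp \<alpha>\<^esub> par \<alpha> s" unfolding std_flag_def by auto
    moreover have "s \<in> idx \<alpha>" using S that by blast
    ultimately show ?thesis using lcos_self[OF g subgroup_par] by simp
  qed
  then show ?thesis using that g S a by (simp add: mem_lcos_parabolic_iff)
qed

section \<open>The geometry property and residues of flags\<close>

lemma geometry_of_flag_transitive:
  assumes "flag_transitive \<alpha>" shows "geometry (coset_system \<alpha>)"
  unfolding geometry_def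
proof (intro conjI incidence_system_coset_system allI impI)
  fix F assume F: "maximal_flag (coset_system \<alpha>) F"
  then have flF: "flag (coset_system \<alpha>) F" unfolding maximal_flag_def by blast
  then obtain g where g: "g \<in> carrier (grp \<alpha>)"
    "F = std_flag \<alpha> g (flag_type (coset_system \<alpha>) F)"
    using assms flag_transitive_iff_std_flag by blast
  have J: "flag_type (coset_system \<alpha>) F \<subseteq> idx \<alpha>" using flF by (rule flag_obtain)
  \<comment> \<open>The flag extends to the chamber formed by all the cosets of g, and by maximality
    it is that chamber.\<close>
  have "F \<subseteq> std_flag \<alpha> g (idx \<alpha>)" using J by (subst g(2)) (auto simp: std_flag_def)
  then have "std_flag \<alpha> g (idx \<alpha>) = F"
    using F flag_std_flag[OF g(1)] unfolding maximal_flag_def by blast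
  then show "chamber (coset_system \<alpha>) F"
    using flF flag_type_std_flag[of \<alpha> g "idx \<alpha>"] unfolding chamber_def by simp
qed

text \<open>An element of the residue and the members of the flag intersect pairwise, so the Helly
  property gives a common element z. It lies in the coset of \<open>parabolic \<alpha> J\<close> by
  g, hence z = g x with x in \<open>parabolic \<alpha> J\<close>, and z represents the new
  coset.\<close>

lemma elements_residue_std_flag:
  assumes ft: "flag_transitive \<alpha>" and J: "J \<subseteq> idx \<alpha>" and g: "g \<in> carrier (grp \<alpha>)"
  shows "elements (residue (coset_system \<alpha>) (std_flag \<alpha> g J)) =
    {(i, (g \<otimes>\<^bsub>grp \<alpha>\<^esub> x) <#\<^bsub>grp \<alpha>\<^esub> par \<alpha> i) | i x. i \<in> idx \<alpha> - J \<and> x \<in> parabolic \<alpha> J}"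
    (is "?E = ?R")
proof (intro subset_antisym subsetI)
  fix e assume "e \<in> ?E"
  then have e: "e \<in> elements (coset_system \<alpha>)" "e \<notin> std_flag \<alpha> g J"
    and meet: "\<And>j. j \<in> J \<Longrightarrow> snd e \<inter> (g <#\<^bsub>grp \<alpha>\<^esub> par \<alpha> j) \<noteq> {}"
    unfolding residue_def std_flag_def by auto
  obtain i h where ih: "e = (i, h <#\<^bsub>grp \<alpha>\<^esub> par \<alpha> i)" "i \<in> idx \<alpha>" "h \<in> carrier (grp \<alpha>)"
    using e(1) unfolding elements_coset_system by auto
  \<comment> \<open>The flag already contains a coset of each type in J, and incidence with it would
    force equality, but a residue omits the elements of its flag.\<close>
  have iJ: "i \<notin> J"
  proof
    assume "i \<in> J"
    then have "(i, g <#\<^bsub>grp \<alpha>\<^esub> par \<alpha> i) \<in> std_flag \<alpha> g J" unfolding std_flag_def by blast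
    moreover have "e = (i, g <#\<^bsub>grp \<alpha>\<^esub> par \<alpha> i)"
      using elements_eq_of_type[OF e(1), of "(i, g <#\<^bsub>grp \<alpha>\<^esub> par \<alpha> i)"] ih g meet[OF \<open>i \<in> J\<close>]
      unfolding elements_coset_system by auto
    ultimately show False using e(2) by simp
  qed
  \<comment> \<open>The coset of h for the new type i, those of g for the types in J;
    \<open>iJ\<close> keeps the two cases apart.\<close>
  let ?a = "\<lambda>j. if j = i then h else g"
  obtain z where z: "z \<in> carrier (grp \<alpha>)"
    "\<And>j. j \<in> insert i J \<Longrightarrow> z \<in> ?a j <#\<^bsub>grp \<alpha>\<^esub> parabolic \<alpha> {j}"
  proof (rule helly_parabolic[OF ft, of "insert i J" "\<lambda>j. {j}" ?a])
    fix k l assume kl: "k \<in> insert i J" "l \<in> insert i J"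
    have p: "parabolic \<alpha> {j} = par \<alpha> j" if "j \<in> insert i J" for j
      using that J ih(2) by (intro parabolic_singleton) auto
    have "g \<in> g <#\<^bsub>grp \<alpha>\<^esub> par \<alpha> j" if "j \<in> J" for j
      using that J g lcos_self subgroup_par by blast
    moreover have "h \<in> h <#\<^bsub>grp \<alpha>\<^esub> par \<alpha> i" using ih lcos_self subgroup_par by blast
    ultimately show "(?a k <#\<^bsub>grp \<alpha>\<^esub> parabolic \<alpha> {k}) \<inter> (?a l <#\<^bsub>grp \<alpha>\<^esub> parabolic \<alpha> {l}) \<noteq> {}"
      using kl iJ meet ih(1) unfolding p[OF kl(1)] p[OF kl(2)] by auto
  qed (use J ih g in auto)
  have zi: "z \<in> h <#\<^bsub>grp \<alpha>\<^esub> par \<alpha> i" using z(2)[of i] ih(2) by (simp add: parabolic_singleton)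
  have zj: "z \<in> g <#\<^bsub>grp \<alpha>\<^esub> par \<alpha> j" if "j \<in> J" for j
    using z(2)[of j] that iJ J by (auto simp: parabolic_singleton subset_iff split: if_splits)
  have "z \<in> g <#\<^bsub>grp \<alpha>\<^esub> parabolic \<alpha> J" using zj z(1) by (simp add: mem_lcos_parabolic_iff g J)
  then obtain x where "x \<in> parabolic \<alpha> J" "z = g \<otimes>\<^bsub>grp \<alpha>\<^esub> x" unfolding l_coset_def by auto
  moreover have "e = (i, z <#\<^bsub>grp \<alpha>\<^esub> par \<alpha> i)"
    using l_repr_independence[OF zi ih(3) subgroup_par[OF ih(2)]] ih(1) by simp
  ultimately show "e \<in> ?R" using iJ ih(2) by blast
next
  fix e assume "e \<in> ?R"
  then obtain i x where e: "e = (i, (g \<otimes>\<^bsub>grp \<alpha>\<^esub> x) <#\<^bsub>grp \<alpha>\<^esub> par \<alpha> i)" and i: "i \<in> idx \<alpha>" "i \<notin> J"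
    and x: "x \<in> parabolic \<alpha> J" by blast
  have xc: "x \<in> carrier (grp \<alpha>)" using x unfolding parabolic_def by blast
  have "g \<otimes>\<^bsub>grp \<alpha>\<^esub> x \<in> g <#\<^bsub>grp \<alpha>\<^esub> parabolic \<alpha> J" using x unfolding l_coset_def by blast
  then have "g \<otimes>\<^bsub>grp \<alpha>\<^esub> x \<in> g <#\<^bsub>grp \<alpha>\<^esub> par \<alpha> j" if "j \<in> J" for j
    using that by (simp add: mem_lcos_parabolic_iff g J)
  moreover have "g \<otimes>\<^bsub>grp \<alpha>\<^esub> x \<in> snd e"
    using e lcos_self[OF _ subgroup_par[OF i(1)]] g xc by simp
  ultimately show "e \<in> ?E"
    unfolding residue_def std_flag_def elements_coset_system using e i g xc by auto
qed

end

section \<open>Residual properties and parabolic subgroups\<close>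

text \<open>Generation is expressed by testing all subgroups H of the whole group. No generated
  subgroup has to be formed, and the same H serves for different sets J in an induction.\<close>

definition generated_by_parabolics :: "('i, 'a) coset_data \<Rightarrow> bool" where
  "generated_by_parabolics \<alpha> \<longleftrightarrow> (\<forall>J H. J \<subseteq> idx \<alpha> \<longrightarrow> 2 \<le> card (idx \<alpha> - J) \<longrightarrow>
     subgroup H (grp \<alpha>) \<longrightarrow> (\<forall>i \<in> idx \<alpha> - J. parabolic \<alpha> (insert i J) \<subseteq> H) \<longrightarrow>
     parabolic \<alpha> J \<subseteq> H)"

context coset_incidence_system
begin

interpretation group "grp \<alpha>" by (rule group_grp)

section \<open>Residual connectedness as generation by parabolic subgroups\<close>

lemma corank_std_flag:
  assumes "J \<subseteq> idx \<alpha>"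
  shows "corank (coset_system \<alpha>) (std_flag \<alpha> g J) = card (idx \<alpha> - J)"
  using assms finite_idx by (simp add: corank_def card_Diff_subset finite_subset)

text \<open>To put x into H, the cosets of \<one> and x, both of one fixed type, are connected by a
  path in the residue of \<open>std_flag \<alpha> \<one> J\<close>, along which membership in H is
  carried.\<close>

lemma generated_by_parabolics_of_residually_connected:
  assumes ft: "flag_transitive \<alpha>" and rc: "residually_connected (coset_system \<alpha>)"
  shows "generated_by_parabolics \<alpha>"
  unfolding generated_by_parabolics_def
proof (intro allI impI subsetI)
  fix J H x
  assume J: "J \<subseteq> idx \<alpha>" and card: "2 \<le> card (idx \<alpha> - J)" and H: "subgroup H (grp \<alpha>)"
    and sub: "\<forall>i \<in> idx \<alpha> - J. parabolic \<alpha> (insert i J) \<subseteq> H" and x: "x \<in> parabolic \<alpha> J"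
  let ?X = "residue (coset_system \<alpha>) (std_flag \<alpha> \<one>\<^bsub>grp \<alpha>\<^esub> J)"
  have carrier: "y \<in> carrier (grp \<alpha>)" if "y \<in> parabolic \<alpha> J" for y
    using that unfolding parabolic_def by blast
  have E: "elements ?X = {(i, (\<one>\<^bsub>grp \<alpha>\<^esub> \<otimes>\<^bsub>grp \<alpha>\<^esub> y) <#\<^bsub>grp \<alpha>\<^esub> par \<alpha> i) | i y. i \<in> idx \<alpha> - J \<and> y \<in> parabolic \<alpha> J}"
    by (rule elements_residue_std_flag[OF ft J one_closed])
  have conn: "connected_system ?X"
    using rc flag_std_flag[OF one_closed J] corank_std_flag[OF J] card
    unfolding residually_connected_def by simp
  \<comment> \<open>Along a path in the residue, the part of each coset inside the parabolic subgroup stays in \<open>H\<close>: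
    adjacent cosets share an element of the parabolic subgroup by the Helly property.\<close>
  have step: "snd e' \<inter> parabolic \<alpha> J \<subseteq> H"
    if e: "(e, e') \<in> incidence_graph ?X" and eH: "snd e \<inter> parabolic \<alpha> J \<subseteq> H" for e e'
  proof
    fix w assume w: "w \<in> snd e' \<inter> parabolic \<alpha> J"
    have eE: "e \<in> elements ?X" "e' \<in> elements ?X" and meet: "snd e \<inter> snd e' \<noteq> {}"
      using e unfolding incidence_graph_def by (auto simp: residue_def)
    obtain i y where y: "e = (i, (\<one>\<^bsub>grp \<alpha>\<^esub> \<otimes>\<^bsub>grp \<alpha>\<^esub> y) <#\<^bsub>grp \<alpha>\<^esub> par \<alpha> i)" "i \<in> idx \<alpha> - J" "y \<in> parabolic \<alpha> J"
      using eE(1) unfolding E by blast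
    obtain k z where z: "e' = (k, (\<one>\<^bsub>grp \<alpha>\<^esub> \<otimes>\<^bsub>grp \<alpha>\<^esub> z) <#\<^bsub>grp \<alpha>\<^esub> par \<alpha> k)" "k \<in> idx \<alpha> - J" "z \<in> parabolic \<alpha> J"
      using eE(2) unfolding E by blast
    \<comment> \<open>Three cosets for the Helly property: the two adjacent ones and
      \<open>parabolic \<alpha> J\<close> as the coset of \<one>. The first two meet by adjacency,
      and y and z witness that they meet the third.\<close>
    let ?S = "\<lambda>n::nat. if n = 0 then {i} else if n = 1 then {k} else J"
    let ?a = "\<lambda>n::nat. if n = 0 then y else if n = 1 then z else \<one>\<^bsub>grp \<alpha>\<^esub>"
    have e_eq: "snd e = y <#\<^bsub>grp \<alpha>\<^esub> par \<alpha> i" "snd e' = z <#\<^bsub>grp \<alpha>\<^esub> par \<alpha> k"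
      using y(1) z(1) carrier[OF y(3)] carrier[OF z(3)] by simp_all
    have p: "parabolic \<alpha> {i} = par \<alpha> i" "parabolic \<alpha> {k} = par \<alpha> k"
      using y(2) z(2) parabolic_singleton by simp_all
    have one_J: "\<one>\<^bsub>grp \<alpha>\<^esub> <#\<^bsub>grp \<alpha>\<^esub> parabolic \<alpha> J = parabolic \<alpha> J"
      using subgroup.subset[OF subgroup_parabolic[OF J]] by (rule lcos_mult_one)
    have yi: "y \<in> y <#\<^bsub>grp \<alpha>\<^esub> par \<alpha> i"
      using lcos_self[OF carrier[OF y(3)] subgroup_par] y(2) by simp
    have zk: "z \<in> z <#\<^bsub>grp \<alpha>\<^esub> par \<alpha> k"
      using lcos_self[OF carrier[OF z(3)] subgroup_par] z(2) by simp
    obtain u where u: "\<And>n. n \<in> {0, 1, 2::nat} \<Longrightarrow> u \<in> ?a n <#\<^bsub>grp \<alpha>\<^esub> parabolic \<alpha> (?S n)"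
    proof (rule helly_parabolic[OF ft, of "{0, 1, 2}" ?S ?a])
      fix m n :: nat assume "m \<in> {0, 1, 2}" "n \<in> {0, 1, 2}"
      then show "(?a m <#\<^bsub>grp \<alpha>\<^esub> parabolic \<alpha> (?S m)) \<inter> (?a n <#\<^bsub>grp \<alpha>\<^esub> parabolic \<alpha> (?S n)) \<noteq> {}"
        using y(3) z(3) yi zk meet by (auto simp: p one_J e_eq)
    qed (use y z J carrier in auto)
    have u_e: "u \<in> snd e" "u \<in> snd e'" "u \<in> parabolic \<alpha> J"
      using u[of 0] u[of 1] u[of 2] by (simp_all add: p one_J e_eq)
    then have uH: "u \<in> H" using eH by blast
    \<comment> \<open>Now w is the product of u and \<open>inv u \<otimes> w\<close>, and the latter
      lies in \<open>parabolic \<alpha> (insert k J)\<close>, a subset of H.\<close>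
    have "snd e' = u <#\<^bsub>grp \<alpha>\<^esub> par \<alpha> k"
      using l_repr_independence[OF _ carrier[OF z(3)] subgroup_par] u_e(2) z(2) e_eq(2) by simp
    then have "inv\<^bsub>grp \<alpha>\<^esub> u \<otimes>\<^bsub>grp \<alpha>\<^esub> w \<in> par \<alpha> k"
      using w mem_lcos_iff[OF carrier[OF u_e(3)] subgroup_par] z(2) by simp
    moreover have "inv\<^bsub>grp \<alpha>\<^esub> u \<otimes>\<^bsub>grp \<alpha>\<^esub> w \<in> parabolic \<alpha> J"
      using w u_e(3) subgroup.m_closed[OF subgroup_parabolic[OF J] subgroup.m_inv_closed[OF subgroup_parabolic[OF J]]]
      by blast
    ultimately have "inv\<^bsub>grp \<alpha>\<^esub> u \<otimes>\<^bsub>grp \<alpha>\<^esub> w \<in> H" using sub z(2) by (auto simp: parabolic_insert)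
    then have "u \<otimes>\<^bsub>grp \<alpha>\<^esub> (inv\<^bsub>grp \<alpha>\<^esub> u \<otimes>\<^bsub>grp \<alpha>\<^esub> w) \<in> H" by (rule subgroup.m_closed[OF H uH])
    moreover have "u \<otimes>\<^bsub>grp \<alpha>\<^esub> (inv\<^bsub>grp \<alpha>\<^esub> u \<otimes>\<^bsub>grp \<alpha>\<^esub> w) = w"
      using carrier u_e(3) w by (metis IntD2 inv_closed m_assoc r_inv l_one)
    ultimately show "w \<in> H" by simp
  qed
  obtain i where i: "i \<in> idx \<alpha> - J" using card by (cases "idx \<alpha> - J = {}") auto
  let ?v = "\<lambda>y. (i, (\<one>\<^bsub>grp \<alpha>\<^esub> \<otimes>\<^bsub>grp \<alpha>\<^esub> y) <#\<^bsub>grp \<alpha>\<^esub> par \<alpha> i)"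
  have one: "\<one>\<^bsub>grp \<alpha>\<^esub> \<in> parabolic \<alpha> J" by (rule subgroup.one_closed[OF subgroup_parabolic[OF J]])
  have "?v \<one>\<^bsub>grp \<alpha>\<^esub> \<in> elements ?X" "?v x \<in> elements ?X" unfolding E using i x one by blast+
  then have path: "(?v \<one>\<^bsub>grp \<alpha>\<^esub>, ?v x) \<in> (incidence_graph ?X)\<^sup>*"
    using conn unfolding connected_system_def by blast
  \<comment> \<open>The path starts at the coset \<open>par \<alpha> i\<close> of \<one>, which
    meets \<open>parabolic \<alpha> J\<close> in
    \<open>parabolic \<alpha> (insert i J)\<close>.\<close>
  have "snd (?v \<one>\<^bsub>grp \<alpha>\<^esub>) \<inter> parabolic \<alpha> J \<subseteq> H"
    using sub i lcos_mult_one[OF subgroup.subset[OF subgroup_par]]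
    by (auto simp: parabolic_insert)
  with path have "snd (?v x) \<inter> parabolic \<alpha> J \<subseteq> H"
    by (induction rule: rtrancl_induct) (auto dest: step)
  moreover have "x \<in> snd (?v x)"
    using lcos_self[OF carrier[OF x] subgroup_par] i carrier[OF x] by simp
  ultimately show "x \<in> H" using x by blast
qed

text \<open>For fixed x the residue elements of all types represented by g x share that element,
  hence are pairwise incident or equal. It remains to join the elements of one type, and those h
  whose right multiplication preserves connected components there form a subgroup to which the
  generation property applies.\<close>

lemma residually_connected_of_generated_by_parabolics:
  assumes ft: "flag_transitive \<alpha>" and gen: "generated_by_parabolics \<alpha>"
  shows "residually_connected (coset_system \<alpha>)"
  unfolding residually_connected_def
proof (intro conjI geometry_of_flag_transitive[OF ft] allI impI, elim conjE)
  fix F assume F: "flag (coset_system \<alpha>) F" and corank: "2 \<le> corank (coset_system \<alpha>) F"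
  obtain g J where g: "g \<in> carrier (grp \<alpha>)" and FJ: "F = std_flag \<alpha> g J" and J: "J \<subseteq> idx \<alpha>"
    using ft[unfolded flag_transitive_iff_std_flag, rule_format, OF F] flag_obtain[OF F] by metis
  have card: "2 \<le> card (idx \<alpha> - J)" using corank unfolding FJ corank_std_flag[OF J] .
  define v where "v i x = (i, (g \<otimes>\<^bsub>grp \<alpha>\<^esub> x) <#\<^bsub>grp \<alpha>\<^esub> par \<alpha> i)" for i x
  define R where "R = (incidence_graph (residue (coset_system \<alpha>) F))\<^sup>*"
  have E: "elements (residue (coset_system \<alpha>) F) = {v i x | i x. i \<in> idx \<alpha> - J \<and> x \<in> parabolic \<alpha> J}"
    unfolding FJ v_def by (rule elements_residue_std_flag[OF ft J g])
  have sgJ: "subgroup (parabolic \<alpha> J) (grp \<alpha>)" by (rule subgroup_parabolic[OF J])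
  have carrier: "y \<in> carrier (grp \<alpha>)" if "y \<in> parabolic \<alpha> J" for y
    using that unfolding parabolic_def by blast
  have sym: "(b, a) \<in> R" if "(a, b) \<in> R" for a b
  proof -
    have "sym (incidence_graph (residue (coset_system \<alpha>) F))"
      unfolding sym_def incidence_graph_def residue_def by auto
    then show ?thesis using that sym_rtrancl unfolding R_def sym_def by blast
  qed
  have trans: "(a, c) \<in> R" if "(a, b) \<in> R" "(b, c) \<in> R" for a b c
    using that unfolding R_def by simp
  have adj: "(v i x, v k x) \<in> R" if "i \<in> idx \<alpha> - J" "k \<in> idx \<alpha> - J" "x \<in> parabolic \<alpha> J" for i k x
  proof (cases "v i x = v k x")
    case False
    have "g \<otimes>\<^bsub>grp \<alpha>\<^esub> x \<in> snd (v i x) \<inter> snd (v k x)"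
      using that g carrier[OF that(3)] lcos_self[OF _ subgroup_par] unfolding v_def by simp
    then have "inc (residue (coset_system \<alpha>) F) (v i x) (v k x)" by (auto simp: residue_def)
    then show ?thesis using False that E unfolding R_def incidence_graph_def by blast
  qed (simp add: R_def)
  obtain i0 where i0: "i0 \<in> idx \<alpha> - J" using card by (cases "idx \<alpha> - J = {}") auto
  \<comment> \<open>Quantifying over all \<open>x\<close>, rather than \<open>x = \<one>\<close> alone, makes \<open>H\<close> closed under products without
    appealing to the action on the residue.\<close>
  define H where "H = {h \<in> parabolic \<alpha> J. \<forall>x \<in> parabolic \<alpha> J. (v i0 x, v i0 (x \<otimes>\<^bsub>grp \<alpha>\<^esub> h)) \<in> R}"
  have "subgroup H (grp \<alpha>)"
  proof (rule subgroup.intro)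
    show "H \<subseteq> carrier (grp \<alpha>)" using carrier unfolding H_def by blast
    show "\<one>\<^bsub>grp \<alpha>\<^esub> \<in> H" using subgroup.one_closed[OF sgJ] carrier unfolding H_def R_def by simp
  next
    fix a b assume ab: "a \<in> H" "b \<in> H"
    have aJ: "a \<in> parabolic \<alpha> J" and bJ: "b \<in> parabolic \<alpha> J" using ab unfolding H_def by auto
    have "(v i0 x, v i0 (x \<otimes>\<^bsub>grp \<alpha>\<^esub> (a \<otimes>\<^bsub>grp \<alpha>\<^esub> b))) \<in> R" if x: "x \<in> parabolic \<alpha> J" for x
    proof -
      have "x \<otimes>\<^bsub>grp \<alpha>\<^esub> a \<in> parabolic \<alpha> J" by (rule subgroup.m_closed[OF sgJ x aJ])
      then have "(v i0 (x \<otimes>\<^bsub>grp \<alpha>\<^esub> a), v i0 ((x \<otimes>\<^bsub>grp \<alpha>\<^esub> a) \<otimes>\<^bsub>grp \<alpha>\<^esub> b)) \<in> R"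
        using ab(2) unfolding H_def by blast
      moreover have "(v i0 x, v i0 (x \<otimes>\<^bsub>grp \<alpha>\<^esub> a)) \<in> R" using ab(1) x unfolding H_def by blast
      ultimately show ?thesis
        using trans m_assoc[OF carrier[OF x] carrier[OF aJ] carrier[OF bJ]] by metis
    qed
    then show "a \<otimes>\<^bsub>grp \<alpha>\<^esub> b \<in> H"
      using subgroup.m_closed[OF sgJ aJ bJ] unfolding H_def by blast
  next
    fix a assume a: "a \<in> H"
    then have aJ: "a \<in> parabolic \<alpha> J" unfolding H_def by blast
    have iJ: "inv\<^bsub>grp \<alpha>\<^esub> a \<in> parabolic \<alpha> J" by (rule subgroup.m_inv_closed[OF sgJ aJ])
    have "(v i0 x, v i0 (x \<otimes>\<^bsub>grp \<alpha>\<^esub> inv\<^bsub>grp \<alpha>\<^esub> a)) \<in> R" if x: "x \<in> parabolic \<alpha> J" for x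
    proof -
      have "x \<otimes>\<^bsub>grp \<alpha>\<^esub> inv\<^bsub>grp \<alpha>\<^esub> a \<in> parabolic \<alpha> J" by (rule subgroup.m_closed[OF sgJ x iJ])
      then have "(v i0 (x \<otimes>\<^bsub>grp \<alpha>\<^esub> inv\<^bsub>grp \<alpha>\<^esub> a), v i0 ((x \<otimes>\<^bsub>grp \<alpha>\<^esub> inv\<^bsub>grp \<alpha>\<^esub> a) \<otimes>\<^bsub>grp \<alpha>\<^esub> a)) \<in> R"
        using a unfolding H_def by blast
      moreover have "(x \<otimes>\<^bsub>grp \<alpha>\<^esub> inv\<^bsub>grp \<alpha>\<^esub> a) \<otimes>\<^bsub>grp \<alpha>\<^esub> a = x"
        using m_assoc[OF carrier[OF x] carrier[OF iJ] carrier[OF aJ]] carrier[OF x] carrier[OF aJ] by simp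
      ultimately show ?thesis using sym by simp
    qed
    then show "inv\<^bsub>grp \<alpha>\<^esub> a \<in> H" using iJ unfolding H_def by blast
  qed
  moreover have "parabolic \<alpha> (insert i J) \<subseteq> H" if i: "i \<in> idx \<alpha> - J" for i
  proof
    fix h assume "h \<in> parabolic \<alpha> (insert i J)"
    then have hJ: "h \<in> parabolic \<alpha> J" and hi: "h \<in> par \<alpha> i" by (auto simp: parabolic_insert)
    \<comment> \<open>A detour through type i: since h lies in \<open>par \<alpha> i\<close>, the
      elements \<open>v i x\<close> and \<open>v i (x \<otimes> h)\<close> coincide, and this
      element is joined both to \<open>v i0 x\<close> and to
      \<open>v i0 (x \<otimes> h)\<close>.\<close>
    have "(v i0 x, v i0 (x \<otimes>\<^bsub>grp \<alpha>\<^esub> h)) \<in> R" if x: "x \<in> parabolic \<alpha> J" for x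
    proof -
      have "v i (x \<otimes>\<^bsub>grp \<alpha>\<^esub> h) = v i x"
        unfolding v_def using lcos_mult_mem[OF g carrier[OF x] subgroup_par hi] i by simp
      moreover have "x \<otimes>\<^bsub>grp \<alpha>\<^esub> h \<in> parabolic \<alpha> J" by (rule subgroup.m_closed[OF sgJ x hJ])
      ultimately show ?thesis
        using adj[OF i0 i x] adj[OF i i0, of "x \<otimes>\<^bsub>grp \<alpha>\<^esub> h"] trans by simp
    qed
    then show "h \<in> H" using hJ unfolding H_def by blast
  qed
  ultimately have JH: "parabolic \<alpha> J \<subseteq> H"
    using gen[unfolded generated_by_parabolics_def, rule_format, OF J card] by blast
  have base: "(v i0 \<one>\<^bsub>grp \<alpha>\<^esub>, v i x) \<in> R" if i: "i \<in> idx \<alpha> - J" and x: "x \<in> parabolic \<alpha> J" for i x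
  proof -
    have "(v i0 \<one>\<^bsub>grp \<alpha>\<^esub>, v i0 (\<one>\<^bsub>grp \<alpha>\<^esub> \<otimes>\<^bsub>grp \<alpha>\<^esub> x)) \<in> R"
      using JH x subgroup.one_closed[OF sgJ] unfolding H_def by blast
    then show ?thesis using adj[OF i0 i x] trans carrier[OF x] by simp
  qed
  show "connected_system (residue (coset_system \<alpha>) F)"
    unfolding connected_system_def R_def[symmetric]
  proof (intro ballI)
    fix e e' assume "e \<in> elements (residue (coset_system \<alpha>) F)" "e' \<in> elements (residue (coset_system \<alpha>) F)"
    then show "(e, e') \<in> R" unfolding E using base sym trans by blast
  qed
qed

text \<open>The generation property enlarges J by one type at a time until a single type is left
  out. For \<open>J = idx \<alpha>\<close> the condition on t would be vacuous, whence the
  properness assumption.\<close>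

lemma parabolic_generated_by_minimal:
  assumes gen: "generated_by_parabolics \<alpha>" and H: "subgroup H (grp \<alpha>)"
    and "J \<subseteq> idx \<alpha>" "J \<noteq> idx \<alpha>" "\<And>t. t \<in> idx \<alpha> - J \<Longrightarrow> parabolic \<alpha> (idx \<alpha> - {t}) \<subseteq> H"
  shows "parabolic \<alpha> J \<subseteq> H"
  using assms(3-5)
proof (induction "card (idx \<alpha> - J)" arbitrary: J rule: less_induct)
  case less
  have fin: "finite (idx \<alpha> - J)" using finite_idx by simp
  show ?case
  proof (cases "2 \<le> card (idx \<alpha> - J)")
    case True
    have "parabolic \<alpha> (insert i J) \<subseteq> H" if i: "i \<in> idx \<alpha> - J" for i
    proof (rule less.hyps)
      have "idx \<alpha> - insert i J \<subset> idx \<alpha> - J" using i by blast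
      then show "card (idx \<alpha> - insert i J) < card (idx \<alpha> - J)" by (rule psubset_card_mono[OF fin])
      show "insert i J \<noteq> idx \<alpha>"
      proof
        assume "insert i J = idx \<alpha>"
        then have "idx \<alpha> - J = {i}" using i by blast
        then show False using True by simp
      qed
      show "insert i J \<subseteq> idx \<alpha>" using i less.prems(1) by blast
      show "parabolic \<alpha> (idx \<alpha> - {t}) \<subseteq> H" if "t \<in> idx \<alpha> - insert i J" for t
        using that by (intro less.prems(3)) blast
    qed
    then show ?thesis
      using gen[unfolded generated_by_parabolics_def, rule_format, OF less.prems(1) True H] by blast
  next
    case False
    moreover have "card (idx \<alpha> - J) \<noteq> 0" using less.prems(1,2) fin by auto
    ultimately have "card (idx \<alpha> - J) = 1" by simp
    then obtain t where t: "idx \<alpha> - J = {t}" by (rule card_1_singletonE)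
    then have "J = idx \<alpha> - {t}" using less.prems(1) by blast
    moreover have "parabolic \<alpha> (idx \<alpha> - {t}) \<subseteq> H" using t by (intro less.prems(3)) blast
    ultimately show ?thesis by simp
  qed
qed

section \<open>Residues of corank one: firmness and thinness\<close>

lemma corank_one_residues_iff:
  assumes ft: "flag_transitive \<alpha>"
  shows "(\<forall>F. flag (coset_system \<alpha>) F \<and> corank (coset_system \<alpha>) F = 1 \<longrightarrow>
      P (elements (residue (coset_system \<alpha>) F))) \<longleftrightarrow>
    (\<forall>i \<in> idx \<alpha>. \<forall>g \<in> carrier (grp \<alpha>).
      P ((\<lambda>x. (i, (g \<otimes>\<^bsub>grp \<alpha>\<^esub> x) <#\<^bsub>grp \<alpha>\<^esub> par \<alpha> i)) ` parabolic \<alpha> (idx \<alpha> - {i})))"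
proof -
  have E: "elements (residue (coset_system \<alpha>) (std_flag \<alpha> g (idx \<alpha> - {i}))) =
      (\<lambda>x. (i, (g \<otimes>\<^bsub>grp \<alpha>\<^esub> x) <#\<^bsub>grp \<alpha>\<^esub> par \<alpha> i)) ` parabolic \<alpha> (idx \<alpha> - {i})"
    if "i \<in> idx \<alpha>" "g \<in> carrier (grp \<alpha>)" for i g
    using that by (subst elements_residue_std_flag[OF ft]) auto
  have std: "flag (coset_system \<alpha>) (std_flag \<alpha> g (idx \<alpha> - {i}))"
    "corank (coset_system \<alpha>) (std_flag \<alpha> g (idx \<alpha> - {i})) = 1"
    if "i \<in> idx \<alpha>" "g \<in> carrier (grp \<alpha>)" for i g
  proof -
    have "idx \<alpha> - (idx \<alpha> - {i}) = {i}" using that(1) by blast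
    then show "corank (coset_system \<alpha>) (std_flag \<alpha> g (idx \<alpha> - {i})) = 1"
      using corank_std_flag[of "idx \<alpha> - {i}" g] by simp
  qed (use that flag_std_flag in simp)
  \<comment> \<open>Corank one means that a single type i is left out, so by flag-transitivity P is
    tested on flags of this shape only.\<close>
  have ex: "\<exists>i \<in> idx \<alpha>. \<exists>g \<in> carrier (grp \<alpha>). F = std_flag \<alpha> g (idx \<alpha> - {i})"
    if F: "flag (coset_system \<alpha>) F" and corank: "corank (coset_system \<alpha>) F = 1" for F
  proof -
    obtain g J where g: "g \<in> carrier (grp \<alpha>)" and FJ: "F = std_flag \<alpha> g J" and J: "J \<subseteq> idx \<alpha>"
      using ft[unfolded flag_transitive_iff_std_flag, rule_format, OF F] flag_obtain[OF F] by metis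
    have "card (idx \<alpha> - J) = 1" using corank unfolding FJ corank_std_flag[OF J] .
    then obtain t where t: "idx \<alpha> - J = {t}" by (rule card_1_singletonE)
    then have "J = idx \<alpha> - {t}" using J by blast
    then show ?thesis using g FJ t by blast
  qed
  show ?thesis using E std ex by metis
qed

text \<open>Residue elements given by x and y differ exactly if \<open>inv x \<otimes> y\<close>
  lies outside \<open>par \<alpha> i\<close>. Choosing x = \<one> turns any element of the parabolic
  subgroup outside \<open>par \<alpha> i\<close> into such a pair.\<close>

lemma firm_iff:
  assumes ft: "flag_transitive \<alpha>"
  shows "firm (coset_system \<alpha>) \<longleftrightarrow> (\<forall>i \<in> idx \<alpha>. \<not> parabolic \<alpha> (idx \<alpha> - {i}) \<subseteq> par \<alpha> i)"
proof -
  have "(\<exists>e \<in> (\<lambda>x. (i, (g \<otimes>\<^bsub>grp \<alpha>\<^esub> x) <#\<^bsub>grp \<alpha>\<^esub> par \<alpha> i)) ` parabolic \<alpha> (idx \<alpha> - {i}).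
      \<exists>e' \<in> (\<lambda>x. (i, (g \<otimes>\<^bsub>grp \<alpha>\<^esub> x) <#\<^bsub>grp \<alpha>\<^esub> par \<alpha> i)) ` parabolic \<alpha> (idx \<alpha> - {i}). e \<noteq> e') \<longleftrightarrow>
    \<not> parabolic \<alpha> (idx \<alpha> - {i}) \<subseteq> par \<alpha> i" (is "?L \<longleftrightarrow> ?R")
    if i: "i \<in> idx \<alpha>" and g: "g \<in> carrier (grp \<alpha>)" for i g
  proof -
    let ?Q = "parabolic \<alpha> (idx \<alpha> - {i})"
    have sgQ: "subgroup ?Q (grp \<alpha>)" by (rule subgroup_parabolic) blast
    note Qc = subgroup.mem_carrier[OF sgQ]
    have "?L \<longleftrightarrow> (\<exists>x \<in> ?Q. \<exists>y \<in> ?Q. inv\<^bsub>grp \<alpha>\<^esub> x \<otimes>\<^bsub>grp \<alpha>\<^esub> y \<notin> par \<alpha> i)"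
      using lcos_mult_eq_iff[OF g Qc Qc subgroup_par[OF i]] by simp
    also have "\<dots> \<longleftrightarrow> ?R"
    proof
      assume ?R
      then obtain y where "y \<in> ?Q" "y \<notin> par \<alpha> i" by blast
      moreover have "inv\<^bsub>grp \<alpha>\<^esub> \<one>\<^bsub>grp \<alpha>\<^esub> \<otimes>\<^bsub>grp \<alpha>\<^esub> y = y" using Qc[OF \<open>y \<in> ?Q\<close>] by simp
      ultimately show "\<exists>x \<in> ?Q. \<exists>y \<in> ?Q. inv\<^bsub>grp \<alpha>\<^esub> x \<otimes>\<^bsub>grp \<alpha>\<^esub> y \<notin> par \<alpha> i"
        using subgroup.one_closed[OF sgQ] by metis
    qed (meson subgroup.m_closed[OF sgQ] subgroup.m_inv_closed[OF sgQ] subsetD)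
    finally show ?thesis .
  qed
  then show ?thesis
    unfolding firm_def corank_one_residues_iff[OF ft, of "\<lambda>E. \<exists>x \<in> E. \<exists>y \<in> E. x \<noteq> y"]
    using geometry_of_flag_transitive[OF ft] one_closed by (metis (no_types, lifting))
qed

text \<open>Two elements of \<open>parabolic \<alpha> (idx \<alpha> - {i})\<close> giving the same
  residue element differ by an element of the Borel subgroup. If this is trivial, the residue is in
  bijection with the parabolic subgroup.\<close>

lemma thin_iff:
  assumes ft: "flag_transitive \<alpha>" and borel: "borel \<alpha> = {\<one>\<^bsub>grp \<alpha>\<^esub>}"
  shows "thin (coset_system \<alpha>) \<longleftrightarrow> (\<forall>i \<in> idx \<alpha>. card (parabolic \<alpha> (idx \<alpha> - {i})) = 2)"
proof -
  have "card ((\<lambda>x. (i, (g \<otimes>\<^bsub>grp \<alpha>\<^esub> x) <#\<^bsub>grp \<alpha>\<^esub> par \<alpha> i)) ` parabolic \<alpha> (idx \<alpha> - {i})) =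
      card (parabolic \<alpha> (idx \<alpha> - {i}))"
    if i: "i \<in> idx \<alpha>" and g: "g \<in> carrier (grp \<alpha>)" for i g
  proof (intro card_image inj_onI)
    let ?Q = "parabolic \<alpha> (idx \<alpha> - {i})"
    have sgQ: "subgroup ?Q (grp \<alpha>)" by (rule subgroup_parabolic) blast
    note Qc = subgroup.mem_carrier[OF sgQ]
    fix x y assume xy: "x \<in> ?Q" "y \<in> ?Q"
      and eq: "(i, (g \<otimes>\<^bsub>grp \<alpha>\<^esub> x) <#\<^bsub>grp \<alpha>\<^esub> par \<alpha> i) = (i, (g \<otimes>\<^bsub>grp \<alpha>\<^esub> y) <#\<^bsub>grp \<alpha>\<^esub> par \<alpha> i)"
    have "inv\<^bsub>grp \<alpha>\<^esub> x \<otimes>\<^bsub>grp \<alpha>\<^esub> y \<in> par \<alpha> i"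
      using eq lcos_mult_eq_iff[OF g Qc[OF xy(1)] Qc[OF xy(2)] subgroup_par[OF i]] by simp
    moreover have "inv\<^bsub>grp \<alpha>\<^esub> x \<otimes>\<^bsub>grp \<alpha>\<^esub> y \<in> ?Q"
      by (rule subgroup.m_closed[OF sgQ subgroup.m_inv_closed[OF sgQ xy(1)] xy(2)])
    ultimately have "inv\<^bsub>grp \<alpha>\<^esub> x \<otimes>\<^bsub>grp \<alpha>\<^esub> y \<in> parabolic \<alpha> (insert i (idx \<alpha> - {i}))"
      unfolding parabolic_insert by blast
    moreover have "insert i (idx \<alpha> - {i}) = idx \<alpha>" using i by blast
    ultimately have "inv\<^bsub>grp \<alpha>\<^esub> x \<otimes>\<^bsub>grp \<alpha>\<^esub> y = \<one>\<^bsub>grp \<alpha>\<^esub>" using borel unfolding borel_def by simp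
    then show "x = y" using Qc[OF xy(1)] Qc[OF xy(2)] by (metis inv_closed inv_inv inv_equality)
  qed
  then show ?thesis
    unfolding thin_def corank_one_residues_iff[OF ft, of "\<lambda>E. card E = 2"]
    using geometry_of_flag_transitive[OF ft] one_closed by (metis (no_types, lifting))
qed

section \<open>Finiteness and cosets of parabolic subgroups\<close>

lemma finite_system_iff:
  "finite_system (coset_system \<alpha>) \<longleftrightarrow>
    (\<forall>i \<in> idx \<alpha>. finite ((\<lambda>g. g <#\<^bsub>grp \<alpha>\<^esub> par \<alpha> i) ` carrier (grp \<alpha>)))"
proof -
  have "elements (coset_system \<alpha>) = (SIGMA i:idx \<alpha>. (\<lambda>g. g <#\<^bsub>grp \<alpha>\<^esub> par \<alpha> i) ` carrier (grp \<alpha>))"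
    unfolding elements_coset_system by blast
  moreover have "finite ((\<lambda>g. g <#\<^bsub>grp \<alpha>\<^esub> par \<alpha> i) ` carrier (grp \<alpha>))"
    if "finite (elements (coset_system \<alpha>))" "i \<in> idx \<alpha>" for i
  proof (rule finite_subset)
    show "finite (snd ` elements (coset_system \<alpha>))" using that(1) by simp
    show "(\<lambda>g. g <#\<^bsub>grp \<alpha>\<^esub> par \<alpha> i) ` carrier (grp \<alpha>) \<subseteq> snd ` elements (coset_system \<alpha>)"
      using that(2) unfolding elements_coset_system by force
  qed
  ultimately show ?thesis
    unfolding finite_system_def using finite_idx by (metis (no_types, lifting) finite_SigmaI)
qed

text \<open>Inside the carrier, each of these cosets is an intersection of cosets of maximal
  parabolic subgroups, so there are no more of them than subsets of the finite set of those
  cosets.\<close>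

lemma finite_lcos_parabolic:
  assumes "finite_system (coset_system \<alpha>)"
  shows "finite {g <#\<^bsub>grp \<alpha>\<^esub> parabolic \<alpha> J | g J. g \<in> carrier (grp \<alpha>) \<and> J \<subseteq> idx \<alpha>}"
proof (rule finite_subset)
  let ?X = "snd ` elements (coset_system \<alpha>)"
  show "finite ((\<lambda>Y. carrier (grp \<alpha>) \<inter> \<Inter> Y) ` Pow ?X)"
    using assms unfolding finite_system_def by simp
  show "{g <#\<^bsub>grp \<alpha>\<^esub> parabolic \<alpha> J | g J. g \<in> carrier (grp \<alpha>) \<and> J \<subseteq> idx \<alpha>} \<subseteq>
      (\<lambda>Y. carrier (grp \<alpha>) \<inter> \<Inter> Y) ` Pow ?X"
  proof clarify
    fix g J assume g: "g \<in> carrier (grp \<alpha>)" and J: "J \<subseteq> idx \<alpha>"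
    have "g <#\<^bsub>grp \<alpha>\<^esub> parabolic \<alpha> J =
        carrier (grp \<alpha>) \<inter> \<Inter> ((\<lambda>j. g <#\<^bsub>grp \<alpha>\<^esub> par \<alpha> j) ` J)"
      using mem_lcos_parabolic_iff[OF g J] by blast
    moreover have "(\<lambda>j. g <#\<^bsub>grp \<alpha>\<^esub> par \<alpha> j) ` J \<subseteq> ?X"
      using g J unfolding elements_coset_system by force
    ultimately show "g <#\<^bsub>grp \<alpha>\<^esub> parabolic \<alpha> J \<in> (\<lambda>Y. carrier (grp \<alpha>) \<inter> \<Inter> Y) ` Pow ?X"
      by blast
  qed
qed

end

section \<open>The twisting\<close>

locale twisting_setup =
  A: coset_incidence_system \<alpha> + B: coset_incidence_system \<beta>
  for \<alpha> :: "('i, 'a) coset_data" and \<beta> :: "('j, 'b) coset_data" +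
  fixes \<phi> :: "'b \<Rightarrow> 'a \<Rightarrow> 'a" and \<sigma> :: "'b \<Rightarrow> 'i \<Rightarrow> 'i" and f :: "'i set \<Rightarrow> 'i"
  assumes phi_hom: "\<phi> \<in> hom (grp \<beta>) (AutoGroup (grp \<alpha>))"
    and admissible: "admissible_with \<alpha> \<beta> \<phi> \<sigma> f"
begin

abbreviation "A \<equiv> grp \<alpha>"
abbreviation "B \<equiv> grp \<beta>"
abbreviation "S \<equiv> semidirect A B \<phi>"
abbreviation "T \<equiv> twisting \<alpha> \<beta> \<phi> \<sigma> f"
abbreviation "K \<equiv> type_orbits \<alpha> \<beta> \<sigma>"

interpretation GA: group A by (rule A.group_grp)
interpretation GB: group B by (rule B.group_grp)

text \<open>The types of the two factors of a maximal parabolic subgroup. An orbit contributes the factor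
  \<open>carrier B\<close>, which is the parabolic subgroup of empty type.\<close>

definition types_left :: "'j + 'i set \<Rightarrow> 'i set" where
  "types_left k = (case k of Inl i \<Rightarrow> \<Union>L \<in> K. L - orbit_upper \<beta> \<sigma> (f L) {i} | Inr L \<Rightarrow> L)"

definition types_right :: "'j + 'i set \<Rightarrow> 'j set" where
  "types_right k = (case k of Inl i \<Rightarrow> {i} | Inr L \<Rightarrow> {})"

lemma types_simps [simp]:
  "types_left (Inl i) = (\<Union>L \<in> K. L - orbit_upper \<beta> \<sigma> (f L) {i})" "types_left (Inr L) = L"
  "types_right (Inl i) = {i}" "types_right (Inr L) = {}"
  by (simp_all add: types_left_def types_right_def)

section \<open>The actions of \<open>B\<close> on the group \<open>A\<close> and on the types of
  \<alpha>\<close>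

lemma phi_auto: "b \<in> carrier B \<Longrightarrow> \<phi> b \<in> hom A A"
  using phi_hom by (auto simp: hom_def AutoGroup_def auto_def)

sublocale phi: group_action B "carrier A" \<phi>
proof (intro group_action.intro group_hom.intro group_hom_axioms.intro)
  show "\<phi> \<in> hom B (BijGroup (carrier A))"
    using phi_hom by (auto simp: hom_def AutoGroup_def auto_def BijGroup_def)
qed (rule B.group_grp group_BijGroup)+

sublocale sigma: group_action B "idx \<alpha>" \<sigma>
  using admissible unfolding admissible_with_def permutes_parabolics_def by blast

lemma phi_closed [simp]: "b \<in> carrier B \<Longrightarrow> a \<in> carrier A \<Longrightarrow> \<phi> b a \<in> carrier A"
  using phi.element_image by blast

lemma phi_one [simp]: "a \<in> carrier A \<Longrightarrow> \<phi> \<one>\<^bsub>B\<^esub> a = a"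
  using phi.id_eq_one by (metis restrict_apply')

lemma phi_mult: "b \<in> carrier B \<Longrightarrow> x \<in> carrier A \<Longrightarrow> y \<in> carrier A \<Longrightarrow>
    \<phi> b (x \<otimes>\<^bsub>A\<^esub> y) = \<phi> b x \<otimes>\<^bsub>A\<^esub> \<phi> b y"
  using hom_mult[OF phi_auto] .

lemma phi_one_right [simp]: "b \<in> carrier B \<Longrightarrow> \<phi> b \<one>\<^bsub>A\<^esub> = \<one>\<^bsub>A\<^esub>"
  using hom_one[OF phi_auto GA.is_group GA.is_group] .

lemma sigma_closed: "b \<in> carrier B \<Longrightarrow> i \<in> idx \<alpha> \<Longrightarrow> \<sigma> b i \<in> idx \<alpha>"
  using sigma.element_image by blast

lemma sigma_one: "i \<in> idx \<alpha> \<Longrightarrow> \<sigma> \<one>\<^bsub>B\<^esub> i = i"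
  using sigma.id_eq_one by (metis restrict_apply')

lemma f_mem: "L \<in> K \<Longrightarrow> f L \<in> L" and f_IPO: "L \<in> K \<Longrightarrow> IPO \<beta> \<sigma> (f L)"
  using admissible unfolding admissible_with_def by auto

lemma K_subset: "L \<in> K \<Longrightarrow> L \<subseteq> idx \<alpha>"
  using sigma.orbits_coverture by blast

lemma f_idx: "L \<in> K \<Longrightarrow> f L \<in> idx \<alpha>"
  using f_mem K_subset by blast

lemma orbit_unique: "L \<in> K \<Longrightarrow> L' \<in> K \<Longrightarrow> t \<in> L \<Longrightarrow> t \<in> L' \<Longrightarrow> L = L'"
  using sigma.disjoint_union by blast

lemma types_left_subset: "k \<in> idx T \<Longrightarrow> types_left k \<subseteq> idx \<alpha>"
  using K_subset[THEN subsetD] by (auto simp: twisting_def)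

lemma types_right_subset: "k \<in> idx T \<Longrightarrow> types_right k \<subseteq> idx \<beta>"
  by (auto simp: twisting_def)

lemma par_T: "k \<in> idx T \<Longrightarrow> par T k = parabolic \<alpha> (types_left k) \<times> parabolic \<beta> (types_right k)"
  using B.parabolic_singleton by (auto simp: twisting_def parabolic_def[of \<beta> "{}"])

lemma grp_T [simp]: "grp T = S"
  and idx_T: "idx T = idx \<beta> <+> K"
  by (simp_all add: twisting_def)

section \<open>The semidirect product and its cosets\<close>

lemma carrier_S [simp]: "carrier S = carrier A \<times> carrier B"
  and mult_S [simp]: "(a, b) \<otimes>\<^bsub>S\<^esub> (a', b') = (a \<otimes>\<^bsub>A\<^esub> \<phi> b a', b \<otimes>\<^bsub>B\<^esub> b')"
  and one_S [simp]: "\<one>\<^bsub>S\<^esub> = (\<one>\<^bsub>A\<^esub>, \<one>\<^bsub>B\<^esub>)"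
  by (simp_all add: semidirect_def)

lemma semidirect_l_inv:
  assumes "a \<in> carrier A" "b \<in> carrier B"
  shows "(\<phi> (inv\<^bsub>B\<^esub> b) (inv\<^bsub>A\<^esub> a), inv\<^bsub>B\<^esub> b) \<otimes>\<^bsub>S\<^esub> (a, b) = \<one>\<^bsub>S\<^esub>"
  using assms by (simp add: phi_mult[symmetric])

lemma group_S: "group S"
proof (rule groupI)
  show "x \<otimes>\<^bsub>S\<^esub> y \<otimes>\<^bsub>S\<^esub> z = x \<otimes>\<^bsub>S\<^esub> (y \<otimes>\<^bsub>S\<^esub> z)"
    if "x \<in> carrier S" "y \<in> carrier S" "z \<in> carrier S" for x y z
    using that by (cases x; cases y; cases z)
      (simp add: phi_mult phi.composition_rule GA.m_assoc GB.m_assoc)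
  show "\<exists>y \<in> carrier S. y \<otimes>\<^bsub>S\<^esub> x = \<one>\<^bsub>S\<^esub>" if x: "x \<in> carrier S" for x
  proof (cases x)
    case (Pair a b)
    then have ab: "a \<in> carrier A" "b \<in> carrier B" using x by auto
    then have "(\<phi> (inv\<^bsub>B\<^esub> b) (inv\<^bsub>A\<^esub> a), inv\<^bsub>B\<^esub> b) \<in> carrier S" by simp
    then show ?thesis using semidirect_l_inv[OF ab] unfolding Pair by blast
  qed
qed auto

lemma inv_S:
  assumes "a \<in> carrier A" "b \<in> carrier B"
  shows "inv\<^bsub>S\<^esub> (a, b) = (\<phi> (inv\<^bsub>B\<^esub> b) (inv\<^bsub>A\<^esub> a), inv\<^bsub>B\<^esub> b)"
  using assms by (intro group.inv_equality[OF group_S] semidirect_l_inv) simp_all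

text \<open>Bijectivity of \<open>\<phi> b\<close> on the carrier lets its image commute with the
  intersection of the subgroups, which it permutes as \<open>\<sigma> b\<close> permutes their
  types.\<close>

lemma phi_parabolic:
  assumes b: "b \<in> carrier B" and J: "J \<subseteq> idx \<alpha>"
  shows "\<phi> b ` parabolic \<alpha> J = parabolic \<alpha> (\<sigma> b ` J)"
proof -
  have img: "\<phi> b ` par \<alpha> i = par \<alpha> (\<sigma> b i)" if "i \<in> J" for i
    using admissible b J that unfolding admissible_with_def permutes_parabolics_def by blast
  have mem: "\<phi> b x \<in> par \<alpha> (\<sigma> b i) \<longleftrightarrow> x \<in> par \<alpha> i" if "i \<in> J" "x \<in> carrier A" for i x
  proof -
    have "par \<alpha> i \<subseteq> carrier A" using subgroup.subset[OF A.subgroup_par] that(1) J by blast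
    then show ?thesis
      using inj_on_image_mem_iff[OF phi.inj_prop[OF b] that(2)] img[OF that(1)] by metis
  qed
  show ?thesis
  proof (intro subset_antisym subsetI)
    fix y assume "y \<in> parabolic \<alpha> (\<sigma> b ` J)"
    then have y: "y \<in> carrier A" "\<And>i. i \<in> J \<Longrightarrow> y \<in> par \<alpha> (\<sigma> b i)" unfolding parabolic_def by auto
    obtain x where x: "x \<in> carrier A" "\<phi> b x = y" using phi.bij_prop1[OF b y(1)] by blast
    then have "x \<in> parabolic \<alpha> J" using y(2) mem unfolding parabolic_def by blast
    then show "y \<in> \<phi> b ` parabolic \<alpha> J" using x(2) by blast
  next
    fix y assume "y \<in> \<phi> b ` parabolic \<alpha> J"
    then obtain x where x: "x \<in> parabolic \<alpha> J" "y = \<phi> b x" by blast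
    then have "x \<in> carrier A" "\<And>i. i \<in> J \<Longrightarrow> x \<in> par \<alpha> i" unfolding parabolic_def by auto
    then show "y \<in> parabolic \<alpha> (\<sigma> b ` J)" using x(2) mem b unfolding parabolic_def by simp
  qed
qed

text \<open>The product of (a, b) and (p, q) has components \<open>a \<otimes> \<phi> b p\<close>
  and \<open>b \<otimes> q\<close>, in which p and q vary independently. Hence the coset is a
  product set, and \<open>\<phi> b\<close> moves the types of its left factor by
  \<open>\<sigma> b\<close>.\<close>

lemma lcos_prod:
  assumes a: "a \<in> carrier A" and b: "b \<in> carrier B" and J: "J \<subseteq> idx \<alpha>"
  shows "(a, b) <#\<^bsub>S\<^esub> (parabolic \<alpha> J \<times> parabolic \<beta> M) =
    (a <#\<^bsub>A\<^esub> parabolic \<alpha> (\<sigma> b ` J)) \<times> (b <#\<^bsub>B\<^esub> parabolic \<beta> M)"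
  unfolding phi_parabolic[OF b J, symmetric] by (auto simp: l_coset_def)

section \<open>Orbits of types and condition (IPO)\<close>

lemma mem_orbit_upper:
  "t \<in> orbit_upper \<beta> \<sigma> s M \<longleftrightarrow> (\<exists>b \<in> parabolic \<beta> M. t = \<sigma> b s)"
  unfolding orbit_upper_def orbit_def by auto

lemma self_mem_orbit_upper:
  assumes "s \<in> idx \<alpha>" "M \<subseteq> idx \<beta>" shows "s \<in> orbit_upper \<beta> \<sigma> s M"
  unfolding mem_orbit_upper
proof (rule bexI)
  show "s = \<sigma> \<one>\<^bsub>B\<^esub> s" using sigma_one[OF assms(1)] by simp
  show "\<one>\<^bsub>B\<^esub> \<in> parabolic \<beta> M" by (rule subgroup.one_closed[OF B.subgroup_parabolic[OF assms(2)]])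
qed

lemma orbit_upper_empty:
  assumes "L \<in> K" shows "orbit_upper \<beta> \<sigma> (f L) {} = L"
proof -
  have orb: "orbit_upper \<beta> \<sigma> (f L) {} = orbit B \<sigma> (f L)"
    unfolding orbit_upper_def orbit_def parabolic_def by simp
  have "orbit B \<sigma> (f L) \<in> K" unfolding orbits_def using f_idx[OF assms] by blast
  then show ?thesis
    using orbit_unique[OF _ assms _ f_mem[OF assms]] sigma.orbit_refl[OF f_idx[OF assms]] orb by simp
qed

text \<open>This is the form in which (IPO) is used: induction over M intersects the orbits one type
  at a time. For M empty the orbit is L itself, which accounts for the assumption
  \<open>t \<in> L\<close>.\<close>

lemma mem_orbit_upper_of_all:
  assumes L: "L \<in> K" and t: "t \<in> L" and M: "M \<subseteq> idx \<beta>"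
    and all: "\<And>i. i \<in> M \<Longrightarrow> t \<in> orbit_upper \<beta> \<sigma> (f L) {i}"
  shows "t \<in> orbit_upper \<beta> \<sigma> (f L) M"
proof -
  have "finite M" using M B.finite_idx finite_subset by blast
  then show ?thesis using M all
  proof (induction M rule: finite_induct)
    case empty
    then show ?case using orbit_upper_empty[OF L] t by simp
  next
    case (insert i M)
    \<comment> \<open>(IPO) speaks of complements, under which the union of M and {i} becomes an
      intersection.\<close>
    have c: "idx \<beta> - (idx \<beta> - N) = N" if "N \<subseteq> idx \<beta>" for N using that by blast
    have "orbit_upper \<beta> \<sigma> (f L) M \<inter> orbit_upper \<beta> \<sigma> (f L) {i} =
        orbit_upper \<beta> \<sigma> (f L) (idx \<beta> - ((idx \<beta> - M) \<inter> (idx \<beta> - {i})))"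
      using f_IPO[OF L, unfolded IPO_def orbit_lower_def, rule_format, of "idx \<beta> - M" "idx \<beta> - {i}"]
        c[of M] c[of "{i}"] insert.prems(1) by simp
    moreover have "idx \<beta> - ((idx \<beta> - M) \<inter> (idx \<beta> - {i})) = insert i M"
      using insert.prems(1) by blast
    ultimately show ?case using insert by auto
  qed
qed

text \<open>Each b in \<open>parabolic \<beta> (types_right k)\<close> preserves every orbit L, and
  for \<open>k = Inl i\<close> also the orbit of \<open>f L\<close> under
  \<open>parabolic \<beta> {i}\<close>, hence the difference of the two. This makes the product set
  \<open>par T k\<close> a subgroup.\<close>

lemma sigma_types_left:
  assumes k: "k \<in> idx T" and b: "b \<in> parabolic \<beta> (types_right k)"
  shows "\<sigma> b ` types_left k = types_left k"
proof -
  have bc: "b \<in> carrier B" if "b \<in> parabolic \<beta> (types_right k)" for b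
    using that unfolding parabolic_def by blast
  have sg: "subgroup (parabolic \<beta> (types_right k)) B"
    by (rule B.subgroup_parabolic[OF types_right_subset[OF k]])
  have orbit_closed: "\<sigma> b t \<in> orbit_upper \<beta> \<sigma> s M"
    if b: "b \<in> parabolic \<beta> M" and t: "t \<in> orbit_upper \<beta> \<sigma> s M"
      and M: "M \<subseteq> idx \<beta>" and s: "s \<in> idx \<alpha>" for b t s M
  proof -
    obtain c where c: "c \<in> parabolic \<beta> M" "t = \<sigma> c s" using t unfolding mem_orbit_upper by blast
    have "b \<otimes>\<^bsub>B\<^esub> c \<in> parabolic \<beta> M"
      by (rule subgroup.m_closed[OF B.subgroup_parabolic[OF M] b c(1)])
    moreover have "\<sigma> (b \<otimes>\<^bsub>B\<^esub> c) s = \<sigma> b t"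
      using sigma.composition_rule[OF s] b c unfolding parabolic_def by simp
    ultimately show ?thesis unfolding mem_orbit_upper by metis
  qed
  have L_closed: "\<sigma> b t \<in> L" if "b \<in> carrier B" "t \<in> L" "L \<in> K" for b t L
    using orbit_closed[of b "{}" t "f L"] orbit_upper_empty[OF that(3)] f_idx[OF that(3)] that
    by (simp add: parabolic_def)
  have sub: "\<sigma> b ` types_left k \<subseteq> types_left k" if b: "b \<in> parabolic \<beta> (types_right k)" for b
  proof (cases k)
    case (Inr L)
    then have "L \<in> K" using k unfolding idx_T by auto
    then show ?thesis using L_closed[OF bc[OF b]] Inr by auto
  next
    case (Inl i)
    then have i: "i \<in> idx \<beta>" using k unfolding idx_T by auto
    show ?thesis
    proof
      fix u assume "u \<in> \<sigma> b ` types_left k"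
      then obtain t L where L: "L \<in> K" and t: "t \<in> L" "t \<notin> orbit_upper \<beta> \<sigma> (f L) {i}" "u = \<sigma> b t"
        using Inl by auto
      \<comment> \<open>If u lay in the suborbit of \<open>f L\<close>, then so would t, its image
        under the inverse of b.\<close>
      have "\<sigma> (inv\<^bsub>B\<^esub> b) u = t"
        by (rule sigma.orbit_sym_aux[OF bc[OF b]]) (use t L K_subset in auto)
      moreover have "inv\<^bsub>B\<^esub> b \<in> parabolic \<beta> {i}"
        using subgroup.m_inv_closed[OF sg b] Inl by simp
      ultimately have "u \<notin> orbit_upper \<beta> \<sigma> (f L) {i}"
        using t(2) orbit_closed[of "inv\<^bsub>B\<^esub> b" "{i}" u "f L"] i f_idx[OF L] by auto
      then show "u \<in> types_left k" using L_closed[OF bc[OF b] t(1) L] L t(3) Inl by auto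
    qed
  qed
  \<comment> \<open>The reverse inclusion is the first one applied to the inverse of b.\<close>
  moreover have "types_left k \<subseteq> \<sigma> b ` types_left k"
  proof
    fix t assume t: "t \<in> types_left k"
    have ti: "t \<in> idx \<alpha>" using types_left_subset[OF k] t by blast
    have "\<sigma> (inv\<^bsub>B\<^esub> b) t \<in> types_left k" using sub[OF subgroup.m_inv_closed[OF sg b]] t by blast
    moreover have "\<sigma> b (\<sigma> (inv\<^bsub>B\<^esub> b) t) = t"
      using sigma.orbit_sym_aux[of "inv\<^bsub>B\<^esub> b" t "\<sigma> (inv\<^bsub>B\<^esub> b) t"] ti bc[OF b] by simp
    ultimately show "t \<in> \<sigma> b ` types_left k" by force
  qed
  ultimately show ?thesis using b by blast
qed

section \<open>The twisting as a coset incidence system\<close>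

lemma subgroup_par_T:
  assumes k: "k \<in> idx T" shows "subgroup (par T k) S"
  unfolding par_T[OF k]
proof (rule subgroup.intro)
  let ?P = "parabolic \<alpha> (types_left k)" and ?Q = "parabolic \<beta> (types_right k)"
  have P: "subgroup ?P A" by (rule A.subgroup_parabolic[OF types_left_subset[OF k]])
  have Q: "subgroup ?Q B" by (rule B.subgroup_parabolic[OF types_right_subset[OF k]])
  have Qc: "b \<in> carrier B" if "b \<in> ?Q" for b using that unfolding parabolic_def by blast
  \<comment> \<open>The right factor acts on the left one: by \<open>sigma_types_left\<close> its
    elements preserve the types of the left factor, hence the factor itself. Closure under products
    and inverses then follows from the formulas in the semidirect product.\<close>
  have phi: "\<phi> b a \<in> ?P" if "a \<in> ?P" "b \<in> ?Q" for a b
    using phi_parabolic[OF Qc[OF that(2)] types_left_subset[OF k]] sigma_types_left[OF k that(2)]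
      that(1) by (metis imageI)
  show "?P \<times> ?Q \<subseteq> carrier S" unfolding parabolic_def by auto
  show "\<one>\<^bsub>S\<^esub> \<in> ?P \<times> ?Q" using subgroup.one_closed[OF P] subgroup.one_closed[OF Q] by simp
  show "x \<otimes>\<^bsub>S\<^esub> y \<in> ?P \<times> ?Q" if "x \<in> ?P \<times> ?Q" "y \<in> ?P \<times> ?Q" for x y
    using that phi subgroup.m_closed[OF P] subgroup.m_closed[OF Q] by (cases x; cases y) simp
  show "inv\<^bsub>S\<^esub> x \<in> ?P \<times> ?Q" if "x \<in> ?P \<times> ?Q" for x
  proof (cases x)
    case (Pair a b)
    then have ab: "a \<in> ?P" "b \<in> ?Q" using that by auto
    then have "a \<in> carrier A" unfolding parabolic_def by blast
    then show ?thesis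
      using ab phi subgroup.m_inv_closed[OF P] subgroup.m_inv_closed[OF Q] inv_S Qc
      unfolding Pair by simp
  qed
qed

sublocale T: coset_incidence_system T
proof (rule coset_incidence_system.intro)
  \<comment> \<open>K is a set of sets with finite union.\<close>
  have "finite K"
    by (rule finite_UnionD) (use sigma.orbits_coverture A.finite_idx in simp)
  then show "finite (idx T)" unfolding idx_T using B.finite_idx by simp
  show "group (grp T)" using group_S by simp
  show "subgroup (par T k) (grp T)" if "k \<in> idx T" for k using subgroup_par_T[OF that] by simp
qed

section \<open>Parabolic subgroups of the twisting and the types of their factors\<close>

definition "left J = (\<Union>k \<in> J. types_left k)"
definition "right J = (\<Union>k \<in> J. types_right k)"

lemma left_subset: "J \<subseteq> idx T \<Longrightarrow> left J \<subseteq> idx \<alpha>"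
  unfolding left_def using types_left_subset by (intro UN_least) blast

lemma right_eq: "right J = {i. Inl i \<in> J}"
  unfolding right_def types_right_def by (auto split: sum.splits)

lemma right_subset: "J \<subseteq> idx T \<Longrightarrow> right J \<subseteq> idx \<beta>"
  unfolding right_eq idx_T by blast

text \<open>Product sets are intersected factor by factor, and intersecting parabolic subgroups
  unites their types.\<close>

lemma parabolic_T:
  assumes "J \<subseteq> idx T"
  shows "parabolic T J = parabolic \<alpha> (left J) \<times> parabolic \<beta> (right J)"
proof -
  have "(\<Inter>k \<in> J. par T k) = (\<Inter>k \<in> J. parabolic \<alpha> (types_left k) \<times> parabolic \<beta> (types_right k))"
    using assms par_T by (intro INF_cong) auto
  then show ?thesis
    unfolding parabolic_def[of T] by (auto simp: parabolic_def left_def right_def)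
qed

text \<open>The representative belongs to its own orbit under each
  \<open>parabolic \<beta> {i}\<close>, so no type \<open>Inl i\<close> contributes it to
  \<open>left J\<close>; since distinct orbits are disjoint, only \<open>Inr L\<close> can.\<close>

lemma f_not_in_left:
  assumes L: "L \<in> K" and "Inr L \<notin> J" and J: "J \<subseteq> idx T"
  shows "f L \<notin> left J"
proof
  assume "f L \<in> left J"
  then obtain k where k: "k \<in> J" "f L \<in> types_left k" unfolding left_def by blast
  show False
  proof (cases k)
    case (Inl i)
    then have i: "{i} \<subseteq> idx \<beta>" using k(1) J unfolding idx_T by auto
    obtain L' where L': "L' \<in> K" "f L \<in> L'" "f L \<notin> orbit_upper \<beta> \<sigma> (f L') {i}"
      using k(2) Inl by auto
    have "L' = L" by (rule orbit_unique[OF L'(1) L L'(2) f_mem[OF L]])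
    then show False using L'(3) self_mem_orbit_upper[OF f_idx[OF L] i] by simp
  next
    case (Inr L')
    then have "L' \<in> K" "f L \<in> L'" using k J unfolding idx_T by auto
    then have "L' = L" using orbit_unique[OF _ L _ f_mem[OF L]] by blast
    then show False using Inr k(1) assms(2) by simp
  qed
qed

text \<open>A type missed by all \<open>Inl i\<close> in J lies in the orbit of \<open>f L\<close>
  under each \<open>parabolic \<beta> {i}\<close>, and (IPO) places it in the orbit under their
  intersection. Thus an element of the right factor of \<open>parabolic T J\<close> moves
  \<open>f L\<close> to t.\<close>

lemma not_in_left:
  assumes J: "J \<subseteq> idx T" and t: "t \<notin> left J" and L: "L \<in> K" "t \<in> L"
  shows "Inr L \<notin> J" and "t \<in> orbit_upper \<beta> \<sigma> (f L) (right J)"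
proof -
  have left: "t \<notin> types_left k" if "k \<in> J" for k using t that unfolding left_def by blast
  show "Inr L \<notin> J" using left[of "Inr L"] L(2) by auto
  show "t \<in> orbit_upper \<beta> \<sigma> (f L) (right J)"
  proof (rule mem_orbit_upper_of_all[OF L right_subset[OF J]])
    fix i assume "i \<in> right J"
    then have "t \<notin> types_left (Inl i)" unfolding right_eq by (intro left) simp
    then show "t \<in> orbit_upper \<beta> \<sigma> (f L) {i}" using L by auto
  qed
qed

section \<open>Flag-transitivity of the twisting\<close>

lemma flag_transitive_twisting:
  assumes ftA: "flag_transitive \<alpha>" and ftB: "flag_transitive \<beta>"
  shows "flag_transitive T"
  unfolding T.flag_transitive_iff_helly helly_def
proof (intro allI impI)
  fix J c
  assume J: "J \<subseteq> idx T" and c: "\<forall>k \<in> J. c k \<in> (\<lambda>g. g <#\<^bsub>grp T\<^esub> par T k) ` carrier (grp T)"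
    and meet: "\<forall>k \<in> J. \<forall>l \<in> J. c k \<inter> c l \<noteq> {}"
  have "\<forall>k \<in> J. \<exists>a b. a \<in> carrier A \<and> b \<in> carrier B \<and> c k = (a, b) <#\<^bsub>S\<^esub> par T k"
  proof
    fix k assume "k \<in> J"
    then have "c k \<in> (\<lambda>g. g <#\<^bsub>S\<^esub> par T k) ` (carrier A \<times> carrier B)" using c by simp
    then show "\<exists>a b. a \<in> carrier A \<and> b \<in> carrier B \<and> c k = (a, b) <#\<^bsub>S\<^esub> par T k" by blast
  qed
  then obtain a b where ab: "\<And>k. k \<in> J \<Longrightarrow> a k \<in> carrier A" "\<And>k. k \<in> J \<Longrightarrow> b k \<in> carrier B"
    "\<And>k. k \<in> J \<Longrightarrow> c k = (a k, b k) <#\<^bsub>S\<^esub> par T k" by metis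
  \<comment> \<open>By \<open>lcos_prod\<close> each given coset is a product set whose left factor
    has its types shifted by \<open>b k\<close>. These left factors are cosets of parabolic
    subgroups of varying types, so the Helly property is needed for all parabolic subgroups.\<close>
  let ?P = "\<lambda>k. \<sigma> (b k) ` types_left k"
  have prod: "c k = (a k <#\<^bsub>A\<^esub> parabolic \<alpha> (?P k)) \<times> (b k <#\<^bsub>B\<^esub> parabolic \<beta> (types_right k))"
    if "k \<in> J" for k
  proof -
    have "k \<in> idx T" using that J by blast
    then show ?thesis using lcos_prod ab[OF that] types_left_subset par_T by simp
  qed
  \<comment> \<open>Product sets that meet do so in each factor, so common elements x and y can be
    found separately in \<alpha> and \<beta>.\<close>
  obtain x where x: "x \<in> carrier A" "\<And>k. k \<in> J \<Longrightarrow> x \<in> a k <#\<^bsub>A\<^esub> parabolic \<alpha> (?P k)"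
  proof (rule A.helly_parabolic[OF ftA, of J ?P a])
    show "?P k \<subseteq> idx \<alpha>" if "k \<in> J" for k
    proof (rule image_subsetI)
      fix t assume "t \<in> types_left k"
      then have "t \<in> idx \<alpha>" using types_left_subset[OF subsetD[OF J that]] by blast
      then show "\<sigma> (b k) t \<in> idx \<alpha>" by (rule sigma_closed[OF ab(2)[OF that]])
    qed
    show "(a k <#\<^bsub>A\<^esub> parabolic \<alpha> (?P k)) \<inter> (a l <#\<^bsub>A\<^esub> parabolic \<alpha> (?P l)) \<noteq> {}"
      if k: "k \<in> J" and l: "l \<in> J" for k l
    proof -
      obtain z where "z \<in> c k" "z \<in> c l" using meet k l by blast
      then show ?thesis unfolding prod[OF k] prod[OF l] by blast
    qed
  qed (use ab in auto)
  obtain y where y: "y \<in> carrier B" "\<And>k. k \<in> J \<Longrightarrow> y \<in> b k <#\<^bsub>B\<^esub> parabolic \<beta> (types_right k)"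
  proof (rule B.helly_parabolic[OF ftB, of J types_right b])
    show "types_right k \<subseteq> idx \<beta>" if "k \<in> J" for k
      using types_right_subset[OF subsetD[OF J that]] .
    show "(b k <#\<^bsub>B\<^esub> parabolic \<beta> (types_right k)) \<inter> (b l <#\<^bsub>B\<^esub> parabolic \<beta> (types_right l)) \<noteq> {}"
      if k: "k \<in> J" and l: "l \<in> J" for k l
    proof -
      obtain z where "z \<in> c k" "z \<in> c l" using meet k l by blast
      then show ?thesis unfolding prod[OF k] prod[OF l] by blast
    qed
  qed (use ab in auto)
  have "(x, y) \<in> c k" if "k \<in> J" for k using x(2) y(2) that prod by simp
  then show "\<exists>g \<in> carrier (grp T). \<forall>k \<in> J. g \<in> c k" using x(1) y(1) by auto
qed

section \<open>Residual connectedness of the twisting\<close>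

lemma subgroup_left:
  assumes H: "subgroup H S" shows "subgroup {a \<in> carrier A. (a, \<one>\<^bsub>B\<^esub>) \<in> H} A"
proof (rule subgroup.intro)
  show "\<one>\<^bsub>A\<^esub> \<in> {a \<in> carrier A. (a, \<one>\<^bsub>B\<^esub>) \<in> H}" using subgroup.one_closed[OF H] by simp
  show "x \<otimes>\<^bsub>A\<^esub> y \<in> {a \<in> carrier A. (a, \<one>\<^bsub>B\<^esub>) \<in> H}"
    if "x \<in> {a \<in> carrier A. (a, \<one>\<^bsub>B\<^esub>) \<in> H}" "y \<in> {a \<in> carrier A. (a, \<one>\<^bsub>B\<^esub>) \<in> H}" for x y
    using that subgroup.m_closed[OF H, of "(x, \<one>\<^bsub>B\<^esub>)" "(y, \<one>\<^bsub>B\<^esub>)"] by simp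
  show "inv\<^bsub>A\<^esub> x \<in> {a \<in> carrier A. (a, \<one>\<^bsub>B\<^esub>) \<in> H}"
    if "x \<in> {a \<in> carrier A. (a, \<one>\<^bsub>B\<^esub>) \<in> H}" for x
    using that subgroup.m_inv_closed[OF H, of "(x, \<one>\<^bsub>B\<^esub>)"] by (simp add: inv_S)
qed blast

lemma subgroup_right:
  assumes H: "subgroup H S" shows "subgroup {b \<in> carrier B. (\<one>\<^bsub>A\<^esub>, b) \<in> H} B"
proof (rule subgroup.intro)
  show "\<one>\<^bsub>B\<^esub> \<in> {b \<in> carrier B. (\<one>\<^bsub>A\<^esub>, b) \<in> H}" using subgroup.one_closed[OF H] by simp
  show "x \<otimes>\<^bsub>B\<^esub> y \<in> {b \<in> carrier B. (\<one>\<^bsub>A\<^esub>, b) \<in> H}"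
    if "x \<in> {b \<in> carrier B. (\<one>\<^bsub>A\<^esub>, b) \<in> H}" "y \<in> {b \<in> carrier B. (\<one>\<^bsub>A\<^esub>, b) \<in> H}" for x y
    using that subgroup.m_closed[OF H, of "(\<one>\<^bsub>A\<^esub>, x)" "(\<one>\<^bsub>A\<^esub>, y)"] by simp
  show "inv\<^bsub>B\<^esub> x \<in> {b \<in> carrier B. (\<one>\<^bsub>A\<^esub>, b) \<in> H}"
    if "x \<in> {b \<in> carrier B. (\<one>\<^bsub>A\<^esub>, b) \<in> H}" for x
    using that subgroup.m_inv_closed[OF H, of "(\<one>\<^bsub>A\<^esub>, x)"] by (simp add: inv_S)
qed blast

text \<open>As (a, b) is the product of (a, \<one>) and (\<one>, b), it suffices to bring the two
  factors of \<open>parabolic T J\<close> into the traces HA and HB of H. If the left factor has all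
  types, only types of \<beta> remain outside J; otherwise the right factor lies in HB at once and
  then helps to move types of \<alpha> within an orbit.\<close>

lemma generated_by_parabolics_twisting:
  assumes genA: "generated_by_parabolics \<alpha>" and genB: "generated_by_parabolics \<beta>"
  shows "generated_by_parabolics T"
  unfolding generated_by_parabolics_def
proof (intro allI impI)
  fix J H
  assume J: "J \<subseteq> idx T" and card: "2 \<le> card (idx T - J)" and "subgroup H (grp T)"
    and sub: "\<forall>k \<in> idx T - J. parabolic T (insert k J) \<subseteq> H"
  then have H: "subgroup H S" by simp
  define HA where "HA = {a \<in> carrier A. (a, \<one>\<^bsub>B\<^esub>) \<in> H}"
  define HB where "HB = {b \<in> carrier B. (\<one>\<^bsub>A\<^esub>, b) \<in> H}"
  have HA: "subgroup HA A" unfolding HA_def by (rule subgroup_left[OF H])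
  have HB: "subgroup HB B" unfolding HB_def by (rule subgroup_right[OF H])
  have sub': "parabolic \<alpha> (left (insert k J)) \<subseteq> HA" "parabolic \<beta> (right (insert k J)) \<subseteq> HB"
    if k: "k \<in> idx T - J" for k
  proof -
    have J': "insert k J \<subseteq> idx T" using k J by blast
    have prod: "parabolic \<alpha> (left (insert k J)) \<times> parabolic \<beta> (right (insert k J)) \<subseteq> H"
      using sub k parabolic_T[OF J'] by blast
    have one: "\<one>\<^bsub>A\<^esub> \<in> parabolic \<alpha> (left (insert k J))" "\<one>\<^bsub>B\<^esub> \<in> parabolic \<beta> (right (insert k J))"
      using subgroup.one_closed[OF A.subgroup_parabolic[OF left_subset[OF J']]]
        subgroup.one_closed[OF B.subgroup_parabolic[OF right_subset[OF J']]] by simp_all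
    show "parabolic \<alpha> (left (insert k J)) \<subseteq> HA"
      using prod one unfolding HA_def by (auto simp: parabolic_def)
    show "parabolic \<beta> (right (insert k J)) \<subseteq> HB"
      using prod one unfolding HB_def by (auto simp: parabolic_def)
  qed
  have insert: "left (insert k J) = left J \<union> types_left k"
    "right (insert k J) = right J \<union> types_right k" for k
    unfolding left_def right_def by auto
  have "parabolic \<alpha> (left J) \<subseteq> HA \<and> parabolic \<beta> (right J) \<subseteq> HB"
  proof (cases "left J = idx \<alpha>")
    case True
    \<comment> \<open>An orbit outside J would leave its representative out of
      \<open>left J\<close>.\<close>
    have "Inr L \<in> J" if "L \<in> K" for L
      using f_not_in_left[OF that _ J] f_idx[OF that] True by blast
    then have idx: "idx T - J = Inl ` (idx \<beta> - right J)" unfolding idx_T right_eq by auto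
    then have "2 \<le> card (idx \<beta> - right J)" using card by (simp add: card_image)
    moreover have "parabolic \<beta> (insert i (right J)) \<subseteq> HB" if "i \<in> idx \<beta> - right J" for i
      using sub'(2)[of "Inl i"] that idx unfolding insert by auto
    ultimately have "parabolic \<beta> (right J) \<subseteq> HB"
      using genB[unfolded generated_by_parabolics_def, rule_format, OF right_subset[OF J] _ HB] by blast
    \<comment> \<open>Adding a type to J does not change the left factor, which already has all
      types.\<close>
    moreover have "parabolic \<alpha> (left J) \<subseteq> HA"
    proof -
      obtain k where k: "k \<in> idx T - J" using card by (cases "idx T - J = {}") auto
      then have "left (insert k J) = left J"
        unfolding insert using types_left_subset True by blast
      then show ?thesis using sub'(1)[OF k] by simp
    qed
    ultimately show ?thesis by blast
  next
    case False
    then obtain t0 where t0: "t0 \<in> idx \<alpha>" "t0 \<notin> left J" using left_subset[OF J] by blast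
    then obtain L0 where L0: "L0 \<in> K" "t0 \<in> L0" using sigma.orbits_coverture by blast
    \<comment> \<open>The orbit of a missing type is itself missing from J, and adding an orbit
      leaves the right factor unchanged.\<close>
    have "Inr L0 \<in> idx T - J" using not_in_left(1)[OF J t0(2) L0] L0(1) unfolding idx_T by blast
    then have B_right: "parabolic \<beta> (right J) \<subseteq> HB" using sub'(2) unfolding insert by fastforce
    have "parabolic \<alpha> (left J) \<subseteq> HA"
    proof (rule A.parabolic_generated_by_minimal[OF genA HA left_subset[OF J] False])
      fix t assume t: "t \<in> idx \<alpha> - left J"
      then obtain L where L: "L \<in> K" "t \<in> L" using sigma.orbits_coverture by blast
      have LJ: "Inr L \<notin> J" and orb: "t \<in> orbit_upper \<beta> \<sigma> (f L) (right J)"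
        using not_in_left[OF J _ L] t by blast+
      \<comment> \<open>Corank at least two provides a missing type k besides \<open>Inr L\<close>.
        If k is another orbit, adding it keeps t missing; if k is some \<open>Inl i\<close>, it may
        cover t but not \<open>f L\<close>.\<close>
      have "\<not> idx T - J \<subseteq> {Inr L}"
        using card card_mono[of "{Inr L}" "idx T - J"] by auto
      then obtain k where k: "k \<in> idx T - J" "k \<noteq> Inr L" by blast
      show "parabolic \<alpha> (idx \<alpha> - {t}) \<subseteq> HA"
      proof (cases k)
        case (Inr L')
        then have "L' \<in> K" "L' \<noteq> L" using k unfolding idx_T by auto
        then have "t \<notin> L'" using orbit_unique L by blast
        then have "left (insert k J) \<subseteq> idx \<alpha> - {t}"
          using t Inr left_subset[OF J] K_subset[OF \<open>L' \<in> K\<close>] unfolding insert by auto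
        then show ?thesis by (rule order_trans[OF parabolic_antimono sub'(1)[OF k(1)]])
      next
        case (Inl i)
        have J': "insert k J \<subseteq> idx T" using k J by blast
        have "f L \<notin> left (insert k J)"
          using f_not_in_left[OF L(1) _ J'] LJ Inl by blast
        then have "left (insert k J) \<subseteq> idx \<alpha> - {f L}" using left_subset[OF J'] by blast
        then have base: "parabolic \<alpha> (idx \<alpha> - {f L}) \<subseteq> HA"
          by (rule order_trans[OF parabolic_antimono sub'(1)[OF k(1)]])
        obtain b where b: "b \<in> parabolic \<beta> (right J)" "t = \<sigma> b (f L)"
          using orb unfolding mem_orbit_upper by blast
        \<comment> \<open>\<open>t\<close> is moved to the representative \<open>f L\<close> by conjugation with \<open>(\<one>, b) \<in> H\<close>.\<close>
        have bH: "b \<in> HB" using b(1) B_right by blast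
        have bH': "inv\<^bsub>B\<^esub> b \<in> HB" by (rule subgroup.m_inv_closed[OF HB bH])
        have bc: "b \<in> carrier B" using bH unfolding HB_def by blast
        have "\<sigma> b ` (idx \<alpha> - {f L}) = idx \<alpha> - {t}"
          using sigma.surj_prop[OF bc] sigma.inj_prop[OF bc] f_idx[OF L(1)] b(2)
          by (simp add: inj_on_image_set_diff)
        then have img: "parabolic \<alpha> (idx \<alpha> - {t}) = \<phi> b ` parabolic \<alpha> (idx \<alpha> - {f L})"
          using phi_parabolic[OF bc, of "idx \<alpha> - {f L}"] by simp
        show ?thesis unfolding img
        proof
          fix x assume "x \<in> \<phi> b ` parabolic \<alpha> (idx \<alpha> - {f L})"
          then obtain a where a: "a \<in> HA" "x = \<phi> b a" using base by blast
          then have ac: "a \<in> carrier A" unfolding HA_def by blast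
          have "(\<one>\<^bsub>A\<^esub>, b) \<otimes>\<^bsub>S\<^esub> (a, \<one>\<^bsub>B\<^esub>) \<in> H"
            using a(1) bH unfolding HA_def HB_def by (intro subgroup.m_closed[OF H]) simp_all
          then have "((\<one>\<^bsub>A\<^esub>, b) \<otimes>\<^bsub>S\<^esub> (a, \<one>\<^bsub>B\<^esub>)) \<otimes>\<^bsub>S\<^esub> (\<one>\<^bsub>A\<^esub>, inv\<^bsub>B\<^esub> b) \<in> H"
            by (rule subgroup.m_closed[OF H]) (use bH' in \<open>simp add: HB_def\<close>)
          then show "x \<in> HA" using ac bc a(2) unfolding HA_def by simp
        qed
      qed
    qed
    then show ?thesis using B_right by blast
  qed
  then show "parabolic T J \<subseteq> H"
  proof -
    assume sub: "parabolic \<alpha> (left J) \<subseteq> HA \<and> parabolic \<beta> (right J) \<subseteq> HB"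
    have "(a, b) \<in> H" if "a \<in> HA" "b \<in> HB" for a b
      using that subgroup.m_closed[OF H, of "(a, \<one>\<^bsub>B\<^esub>)" "(\<one>\<^bsub>A\<^esub>, b)"] unfolding HA_def HB_def by simp
    then show ?thesis using sub unfolding parabolic_T[OF J] by blast
  qed
qed

section \<open>Firmness and thinness of the twisting\<close>

lemma left_full:
  assumes "J \<subseteq> idx T" "Inr ` K \<subseteq> J" shows "left J = idx \<alpha>"
proof
  show "idx \<alpha> \<subseteq> left J"
  proof
    fix t assume "t \<in> idx \<alpha>"
    then obtain L where "L \<in> K" "t \<in> L" using sigma.orbits_coverture by blast
    then have "Inr L \<in> J" "t \<in> types_left (Inr L)" using assms(2) by auto
    then show "t \<in> left J" unfolding left_def by blast
  qed
qed (rule left_subset[OF assms(1)])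

text \<open>A witness for the firmness of one factor, paired with the identity of the other, serves
  for the twisting.\<close>

lemma firm_twisting:
  assumes ft: "flag_transitive \<alpha>" "flag_transitive \<beta>"
    and firm: "firm (coset_system \<alpha>)" "firm (coset_system \<beta>)"
  shows "firm (coset_system T)"
  unfolding T.firm_iff[OF flag_transitive_twisting[OF ft]]
proof
  fix k assume k: "k \<in> idx T"
  let ?J = "idx T - {k}"
  have J: "?J \<subseteq> idx T" by blast
  have one: "\<one>\<^bsub>A\<^esub> \<in> parabolic \<alpha> (left ?J)" "\<one>\<^bsub>B\<^esub> \<in> parabolic \<beta> (right ?J)"
    using subgroup.one_closed[OF A.subgroup_parabolic[OF left_subset[OF J]]]
      subgroup.one_closed[OF B.subgroup_parabolic[OF right_subset[OF J]]] by simp_all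
  show "\<not> parabolic T ?J \<subseteq> par T k"
  proof (cases k)
    case (Inl i)
    then have i: "i \<in> idx \<beta>" using k unfolding idx_T by auto
    obtain b where b: "b \<in> parabolic \<beta> (idx \<beta> - {i})" "b \<notin> par \<beta> i"
      using firm(2) i unfolding B.firm_iff[OF ft(2)] by blast
    have "right ?J = idx \<beta> - {i}" unfolding right_eq idx_T Inl by auto
    then have "(\<one>\<^bsub>A\<^esub>, b) \<in> parabolic T ?J" using b(1) one(1) unfolding parabolic_T[OF J] by simp
    moreover have "(\<one>\<^bsub>A\<^esub>, b) \<notin> par T k"
      using b(2) B.parabolic_singleton[OF i] Inl unfolding par_T[OF k] by simp
    ultimately show ?thesis by blast
  next
    case (Inr L)
    then have L: "L \<in> K" using k unfolding idx_T by auto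
    \<comment> \<open>Among the types in L, \<open>f L\<close> is chosen because
      \<open>f_not_in_left\<close> guarantees that it is absent from \<open>left ?J\<close>.\<close>
    obtain a where a: "a \<in> parabolic \<alpha> (idx \<alpha> - {f L})" "a \<notin> par \<alpha> (f L)"
      using firm(1) f_idx[OF L] unfolding A.firm_iff[OF ft(1)] by blast
    have "f L \<notin> left ?J" using f_not_in_left[OF L _ J] Inr by blast
    then have "left ?J \<subseteq> idx \<alpha> - {f L}" using left_subset[OF J] by blast
    then have "a \<in> parabolic \<alpha> (left ?J)" by (rule subsetD[OF parabolic_antimono a(1)])
    then have "(a, \<one>\<^bsub>B\<^esub>) \<in> parabolic T ?J" using one(2) unfolding parabolic_T[OF J] by simp
    moreover have "(a, \<one>\<^bsub>B\<^esub>) \<notin> par T k"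
      using a(2) f_mem[OF L] Inr unfolding par_T[OF k] parabolic_def by auto
    ultimately show ?thesis by blast
  qed
qed

text \<open>A parabolic subgroup of corank one is here the product of one of corank one in one
  factor, of order two, and the trivial Borel subgroup of the other.\<close>

lemma thin_twisting:
  assumes ft: "flag_transitive \<alpha>" "flag_transitive \<beta>"
    and borel: "borel \<alpha> = {\<one>\<^bsub>A\<^esub>}" "borel \<beta> = {\<one>\<^bsub>B\<^esub>}"
    and thin: "thin (coset_system \<alpha>)" "thin (coset_system \<beta>)"
  shows "thin (coset_system T)"
proof -
  have right_full: "right (idx T) = idx \<beta>" unfolding right_eq idx_T by auto
  have left: "left (idx T) = idx \<alpha>" by (rule left_full) (auto simp: idx_T)
  have borel_T: "borel T = {\<one>\<^bsub>grp T\<^esub>}"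
    using borel parabolic_T[OF subset_refl] unfolding borel_def left right_full by simp
  show ?thesis
    unfolding T.thin_iff[OF flag_transitive_twisting[OF ft] borel_T]
  proof
    fix k assume k: "k \<in> idx T"
    let ?J = "idx T - {k}"
    have J: "?J \<subseteq> idx T" by blast
    show "card (parabolic T ?J) = 2"
    proof (cases k)
      case (Inl i)
      then have i: "i \<in> idx \<beta>" using k unfolding idx_T by auto
      have r: "right ?J = idx \<beta> - {i}" unfolding right_eq idx_T Inl by auto
      have l: "left ?J = idx \<alpha>" by (rule left_full[OF J]) (auto simp: idx_T Inl)
      have "card (parabolic \<beta> (idx \<beta> - {i})) = 2"
        using thin(2) i unfolding B.thin_iff[OF ft(2) borel(2)] by blast
      then show ?thesis
        using borel(1) unfolding parabolic_T[OF J] r l borel_def by (simp add: card_cartesian_product)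
    next
      case (Inr L)
      then have L: "L \<in> K" using k unfolding idx_T by auto
      have r: "right ?J = idx \<beta>" unfolding right_eq idx_T Inr by auto
      \<comment> \<open>By (IPO) a type absent from \<open>left ?J\<close> lies in the orbit of
        \<open>f L\<close> under the Borel subgroup of \<beta>, which consists of \<open>f L\<close>
        alone because that subgroup is trivial.\<close>
      have "t = f L" if t: "t \<in> idx \<alpha>" "t \<notin> left ?J" for t
      proof -
        obtain L' where L': "L' \<in> K" "t \<in> L'" using t(1) sigma.orbits_coverture by blast
        have "L' = L" using not_in_left(1)[OF J t(2) L'] L'(1) Inr unfolding idx_T by auto
        then have "t \<in> orbit_upper \<beta> \<sigma> (f L) (idx \<beta>)" using not_in_left(2)[OF J t(2) L'] r by simp
        then show "t = f L"
          using borel(2) sigma_one[OF f_idx[OF L]] unfolding mem_orbit_upper borel_def by simp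
      qed
      moreover have "f L \<notin> left ?J" using f_not_in_left[OF L _ J] Inr by blast
      ultimately have l: "left ?J = idx \<alpha> - {f L}" using left_subset[OF J] by blast
      have "card (parabolic \<alpha> (idx \<alpha> - {f L})) = 2"
        using thin(1) f_idx[OF L] unfolding A.thin_iff[OF ft(1) borel(1)] by blast
      then show ?thesis
        using borel(2) unfolding parabolic_T[OF J] r l borel_def by (simp add: card_cartesian_product)
    qed
  qed
qed

section \<open>Finiteness of the twisting\<close>

lemma finite_twisting_iff:
  "finite_system (coset_system T) \<longleftrightarrow>
    finite_system (coset_system \<alpha>) \<and> finite_system (coset_system \<beta>)"
proof (intro iffI conjI)
  assume fin: "finite_system (coset_system \<alpha>) \<and> finite_system (coset_system \<beta>)"
  \<comment> \<open>By \<open>lcos_prod\<close> every coset of a maximal parabolic subgroup of the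
    twisting is the product of a member of ?X and a member of ?Y, and both families are
    finite.\<close>
  let ?X = "{g <#\<^bsub>A\<^esub> parabolic \<alpha> J | g J. g \<in> carrier A \<and> J \<subseteq> idx \<alpha>}"
  let ?Y = "{g <#\<^bsub>B\<^esub> parabolic \<beta> J | g J. g \<in> carrier B \<and> J \<subseteq> idx \<beta>}"
  show "finite_system (coset_system T)" unfolding T.finite_system_iff
  proof
    fix k assume k: "k \<in> idx T"
    show "finite ((\<lambda>g. g <#\<^bsub>grp T\<^esub> par T k) ` carrier (grp T))"
    proof (rule finite_subset)
      show "finite ((\<lambda>(x, y). x \<times> y) ` (?X \<times> ?Y))"
        using A.finite_lcos_parabolic B.finite_lcos_parabolic fin by simp
      show "(\<lambda>g. g <#\<^bsub>grp T\<^esub> par T k) ` carrier (grp T) \<subseteq> (\<lambda>(x, y). x \<times> y) ` (?X \<times> ?Y)"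
      proof
        fix C assume "C \<in> (\<lambda>g. g <#\<^bsub>grp T\<^esub> par T k) ` carrier (grp T)"
        then obtain a b where ab: "a \<in> carrier A" "b \<in> carrier B" and C: "C = (a, b) <#\<^bsub>S\<^esub> par T k"
          by auto
        have sub: "\<sigma> b ` types_left k \<subseteq> idx \<alpha>"
          using types_left_subset[OF k] sigma_closed[OF ab(2)] by (intro image_subsetI) (meson subsetD)
        have "C = (a <#\<^bsub>A\<^esub> parabolic \<alpha> (\<sigma> b ` types_left k)) \<times> (b <#\<^bsub>B\<^esub> parabolic \<beta> (types_right k))"
          unfolding C par_T[OF k] by (rule lcos_prod[OF ab types_left_subset[OF k]])
        moreover have "a <#\<^bsub>A\<^esub> parabolic \<alpha> (\<sigma> b ` types_left k) \<in> ?X" using ab(1) sub by blast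
        moreover have "b <#\<^bsub>B\<^esub> parabolic \<beta> (types_right k) \<in> ?Y"
          using ab(2) types_right_subset[OF k] by blast
        ultimately show "C \<in> (\<lambda>(x, y). x \<times> y) ` (?X \<times> ?Y)" by force
      qed
    qed
  qed
next
  assume fin: "finite_system (coset_system T)"
  let ?C = "\<lambda>k. (\<lambda>g. g <#\<^bsub>grp T\<^esub> par T k) ` carrier (grp T)"
  have finC: "finite (?C k)" if "k \<in> idx T" for k using fin that unfolding T.finite_system_iff by blast
  show "finite_system (coset_system \<alpha>)" unfolding A.finite_system_iff
  proof
    fix i assume i: "i \<in> idx \<alpha>"
    then obtain L where L: "L \<in> K" "i \<in> L" using sigma.orbits_coverture by blast
    have k: "Inr L \<in> idx T" using L unfolding idx_T by blast
    show "finite ((\<lambda>g. g <#\<^bsub>A\<^esub> par \<alpha> i) ` carrier A)"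
    proof (rule finite_subset)
      \<comment> \<open>With L the orbit of i, multiplying the first projection of the coset of (a,
        \<one>) by \<open>par \<alpha> i\<close> recovers the coset of \<open>par \<alpha> i\<close>
        by a, since \<open>parabolic \<alpha> L\<close> is contained in
        \<open>par \<alpha> i\<close>.\<close>
      show "finite ((\<lambda>X. fst ` X <#>\<^bsub>A\<^esub> par \<alpha> i) ` ?C (Inr L))" using finC[OF k] by simp
      show "(\<lambda>g. g <#\<^bsub>A\<^esub> par \<alpha> i) ` carrier A \<subseteq> (\<lambda>X. fst ` X <#>\<^bsub>A\<^esub> par \<alpha> i) ` ?C (Inr L)"
      proof clarify
        fix a assume a: "a \<in> carrier A"
        let ?X = "(a, \<one>\<^bsub>B\<^esub>) <#\<^bsub>S\<^esub> par T (Inr L)"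
        have si: "subgroup (par \<alpha> i) A" by (rule A.subgroup_par[OF i])
        have sL: "subgroup (parabolic \<alpha> L) A" by (rule A.subgroup_parabolic[OF K_subset[OF L(1)]])
        have "\<sigma> \<one>\<^bsub>B\<^esub> ` L = L" using sigma_one K_subset[OF L(1)] by (auto simp: image_iff subset_iff)
        then have "?X = (a <#\<^bsub>A\<^esub> parabolic \<alpha> L) \<times> (\<one>\<^bsub>B\<^esub> <#\<^bsub>B\<^esub> parabolic \<beta> {})"
          unfolding par_T[OF k] using lcos_prod[OF a GB.one_closed K_subset[OF L(1)]] by simp
        moreover have "\<one>\<^bsub>B\<^esub> \<in> \<one>\<^bsub>B\<^esub> <#\<^bsub>B\<^esub> parabolic \<beta> {}"
          using GB.lcos_self[OF GB.one_closed B.subgroup_parabolic] by blast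
        ultimately have fst: "fst ` ?X = a <#\<^bsub>A\<^esub> parabolic \<alpha> L"
          by (simp only: fst_image_times) auto
        have sub: "parabolic \<alpha> L \<subseteq> par \<alpha> i" using L(2) unfolding parabolic_def by blast
        have "parabolic \<alpha> L <#>\<^bsub>A\<^esub> par \<alpha> i = par \<alpha> i"
        proof (intro subset_antisym subsetI)
          fix x assume "x \<in> parabolic \<alpha> L <#>\<^bsub>A\<^esub> par \<alpha> i"
          then obtain y z where "y \<in> par \<alpha> i" "z \<in> par \<alpha> i" "x = y \<otimes>\<^bsub>A\<^esub> z"
            using sub unfolding set_mult_def by blast
          then show "x \<in> par \<alpha> i" using subgroup.m_closed[OF si] by simp
        next
          fix x assume x: "x \<in> par \<alpha> i"
          then have "x = \<one>\<^bsub>A\<^esub> \<otimes>\<^bsub>A\<^esub> x" using subgroup.mem_carrier[OF si] by simp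
          then show "x \<in> parabolic \<alpha> L <#>\<^bsub>A\<^esub> par \<alpha> i"
            using x subgroup.one_closed[OF sL] unfolding set_mult_def by blast
        qed
        then have "a <#\<^bsub>A\<^esub> par \<alpha> i = fst ` ?X <#>\<^bsub>A\<^esub> par \<alpha> i"
          using GA.setmult_lcos_assoc[OF subgroup.subset[OF sL] subgroup.subset[OF si] a]
          unfolding fst by simp
        moreover have "?X \<in> ?C (Inr L)" using a by auto
        ultimately show "a <#\<^bsub>A\<^esub> par \<alpha> i \<in> (\<lambda>X. fst ` X <#>\<^bsub>A\<^esub> par \<alpha> i) ` ?C (Inr L)"
          by (rule image_eqI)
      qed
    qed
  qed
  show "finite_system (coset_system \<beta>)" unfolding B.finite_system_iff
  proof
    fix i assume i: "i \<in> idx \<beta>"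
    have k: "Inl i \<in> idx T" using i unfolding idx_T by blast
    show "finite ((\<lambda>g. g <#\<^bsub>B\<^esub> par \<beta> i) ` carrier B)"
    proof (rule finite_subset)
      \<comment> \<open>For \<beta> the second projection recovers the coset directly, since the
        first factor of the product set is nonempty.\<close>
      show "finite ((\<lambda>X. snd ` X) ` ?C (Inl i))" using finC[OF k] by simp
      show "(\<lambda>g. g <#\<^bsub>B\<^esub> par \<beta> i) ` carrier B \<subseteq> (\<lambda>X. snd ` X) ` ?C (Inl i)"
      proof clarify
        fix b assume b: "b \<in> carrier B"
        let ?X = "(\<one>\<^bsub>A\<^esub>, b) <#\<^bsub>S\<^esub> par T (Inl i)"
        let ?P = "\<one>\<^bsub>A\<^esub> <#\<^bsub>A\<^esub> parabolic \<alpha> (\<sigma> b ` types_left (Inl i))"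
        have X: "?X = ?P \<times> (b <#\<^bsub>B\<^esub> par \<beta> i)"
          unfolding par_T[OF k] lcos_prod[OF GA.one_closed b types_left_subset[OF k]]
          using B.parabolic_singleton[OF i] by simp
        have "\<sigma> b ` types_left (Inl i) \<subseteq> idx \<alpha>"
          using types_left_subset[OF k] sigma_closed[OF b] by (intro image_subsetI) (meson subsetD)
        then have "\<one>\<^bsub>A\<^esub> \<in> ?P" by (intro GA.lcos_self GA.one_closed A.subgroup_parabolic)
        then have "b <#\<^bsub>B\<^esub> par \<beta> i = snd ` ?X" unfolding X by (simp only: snd_image_times) auto
        moreover have "?X \<in> ?C (Inl i)" using b by auto
        ultimately show "b <#\<^bsub>B\<^esub> par \<beta> i \<in> (\<lambda>X. snd ` X) ` ?C (Inl i)" by (rule image_eqI)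
      qed
    qed
  qed
qed

end


section \<open>Combination of the inherited properties\<close>

theorem theorem3p16:
  fixes \<alpha> :: "('i, 'a) coset_data"
    and \<beta> :: "('j, 'b) coset_data"
    and \<phi> :: "'b \<Rightarrow> 'a \<Rightarrow> 'a"
    and \<sigma> :: "'b \<Rightarrow> 'i \<Rightarrow> 'i"
    and f :: "'i set \<Rightarrow> 'i"
  assumes "coset_incidence_system \<alpha>"
    and "coset_incidence_system \<beta>"
    and "\<phi> \<in> hom (grp \<beta>) (AutoGroup (grp \<alpha>))"
    and "admissible_with \<alpha> \<beta> \<phi> \<sigma> f"
    and "flag_transitive \<alpha>"
    and "flag_transitive \<beta>"
  shows
    "flag_transitive (twisting \<alpha> \<beta> \<phi> \<sigma> f) \<and>
     coset_geometry (twisting \<alpha> \<beta> \<phi> \<sigma> f) \<and>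
     (finite_coset_geometry (twisting \<alpha> \<beta> \<phi> \<sigma> f) \<longleftrightarrow>
       finite_coset_geometry \<alpha> \<and> finite_coset_geometry \<beta>) \<and>
     (residually_connected (coset_system \<alpha>) \<and> residually_connected (coset_system \<beta>) \<longrightarrow>
       residually_connected (coset_system (twisting \<alpha> \<beta> \<phi> \<sigma> f))) \<and>
     (firm (coset_system \<alpha>) \<and> firm (coset_system \<beta>) \<longrightarrow>
       firm (coset_system (twisting \<alpha> \<beta> \<phi> \<sigma> f))) \<and>
     (borel \<alpha> = {\<one>\<^bsub>grp \<alpha>\<^esub>} \<and> borel \<beta> = {\<one>\<^bsub>grp \<beta>\<^esub>} \<longrightarrow>
       thin (coset_system \<alpha>) \<and> thin (coset_system \<beta>) \<longrightarrow>
       thin (coset_system (twisting \<alpha> \<beta> \<phi> \<sigma> f)))"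
proof -
  interpret twisting_setup \<alpha> \<beta> \<phi> \<sigma> f
    by (intro twisting_setup.intro twisting_setup_axioms.intro assms)
  have ft: "flag_transitive (twisting \<alpha> \<beta> \<phi> \<sigma> f)"
    by (rule flag_transitive_twisting[OF assms(5,6)])
  have geo: "coset_geometry (twisting \<alpha> \<beta> \<phi> \<sigma> f)" "coset_geometry \<alpha>" "coset_geometry \<beta>"
    unfolding coset_geometry_def
    using T.geometry_of_flag_transitive[OF ft] T.coset_incidence_system_axioms
      A.geometry_of_flag_transitive[OF assms(5)] B.geometry_of_flag_transitive[OF assms(6)] assms(1,2)
    by blast+
  show ?thesis
  proof (intro conjI impI)
    \<comment> \<open>Flag-transitivity makes all three systems geometries, so only the finiteness
      of the element sets is left to compare.\<close>
    show "finite_coset_geometry (twisting \<alpha> \<beta> \<phi> \<sigma> f) \<longleftrightarrow>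
        finite_coset_geometry \<alpha> \<and> finite_coset_geometry \<beta>"
      unfolding finite_coset_geometry_def using geo finite_twisting_iff by blast
    show "residually_connected (coset_system (twisting \<alpha> \<beta> \<phi> \<sigma> f))"
      if "residually_connected (coset_system \<alpha>) \<and> residually_connected (coset_system \<beta>)"
      using that T.residually_connected_of_generated_by_parabolics[OF ft]
        generated_by_parabolics_twisting
        A.generated_by_parabolics_of_residually_connected[OF assms(5)]
        B.generated_by_parabolics_of_residually_connected[OF assms(6)] by blast
  qed (use ft geo firm_twisting thin_twisting assms(5,6) in blast)+
qed

end
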